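(* Let $L$ be a rational polytope in $\mathbb{R}^m$ that is lattice-free in its affine hull $A$, and assume $\dim(A)\ge1$ and $A$ contains integer points. Then there exists a rational polytope $L'$ with $L\subseteq L'\subseteq A$, lattice-free in its affine hull, such that $L$ has the 2-hyperplane property if and only if $L'$ does, and such that for each facet $F$ of $L'$: (i) the affine hull of $F$ contains integer points; (ii) the split $(\pi^A(F),\pi^A_0(F))$ is $L'$-intersecting.
   Context: A convex set is lattice-free in its affine hull if its relative interior contains no integer point. Since $A$ is the affine hull of a rational polytope and contains integer points, it is a lattice subspace (spanned by its integer points). A split in $\mathbb{R}^m$ is $(\pi,\pi_0)$, $\pi\in\mathbb{Z}^m$, $\pi_0\in\mathbb{Z}$, with boundary hyperplanes $\{\pi x=\pi_0\}$ and $\{\pi x=\pi_0+1\}$; a split within $A$ is a pair of parallel rational hyperplanes of $A$ (codimension one in $A$), each containing integer points, with no integer point of $A$ strictly between them. Facets and faces of $L'$ are taken relative to $A$. For a facet $F$ of $L'$, $(\pi^A(F),\pi^A_0(F))$ is the split within $A$ whose boundary hyperplanes $H^1,H^2$ (in $A$) are parallel to $F$, with $F$ between $H^1$ and $H^2$ (possibly on $H^1$) and some points of $L'$ strictly between $F$ and $H^2$. A split is $L'$-intersecting if both its boundary hyperplanes meet $L'$. A set of points is 2-partitionable if it has at most one element or it can be partitioned into two nonempty sets lying respectively on the two boundary hyperplanes of some split. For a polytope $K$ lattice-free in its affine hull, $K_I$ is the convex hull of the integer points of $K$, and $K$ has the 2-hyperplane property if every face of $K_I$ not contained in a facet of $K$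 has a 2-partitionable set of integer points. *)

theory Defs
  imports "HOL-Analysis.Analysis"
begin

definition int_points :: "(real^'m) set" where
  "int_points = {x. \<forall>i. x $ i \<in> \<int>}"

definition rat_vec :: "real^'m \<Rightarrow> bool" where
  "rat_vec x \<longleftrightarrow> (\<forall>i. x $ i \<in> \<rat>)"

definition rational_polytope :: "(real^'m) set \<Rightarrow> bool" where
  "rational_polytope P \<longleftrightarrow> (\<exists>S. finite S \<and> (\<forall>x\<in>S. rat_vec x) \<and> P = convex hull S)"

definition lattice_free_in_aff :: "(real^'m) set \<Rightarrow> bool" where
  "lattice_free_in_aff K \<longleftrightarrow> convex K \<and> rel_interior K \<inter> int_points = {}"

definition strictly_between :: "real \<Rightarrow> real \<Rightarrow> real \<Rightarrow> bool" where
  "strictly_between u v w \<longleftrightarrow> (u < w \<and> w < v) \<or> (v < w \<and> w < u)"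

definition split_within_data :: "(real^'m) set \<Rightarrow> real^'m \<Rightarrow> real \<Rightarrow> real \<Rightarrow> bool" where
  "split_within_data A a b1 b2 \<longleftrightarrow>
     rat_vec a \<and> (\<exists>x\<in>A. \<exists>y\<in>A. a \<bullet> x \<noteq> a \<bullet> y) \<and> b1 \<noteq> b2 \<and>
     A \<inter> {x. a \<bullet> x = b1} \<inter> int_points \<noteq> {} \<and>
     A \<inter> {x. a \<bullet> x = b2} \<inter> int_points \<noteq> {} \<and>
     \<not> (\<exists>z\<in>A \<inter> int_points. strictly_between b1 b2 (a \<bullet> z))"

definition split_within :: "(real^'m) set \<Rightarrow> (real^'m) set \<Rightarrow> (real^'m) set \<Rightarrow> bool" where
  "split_within A H1 H2 \<longleftrightarrow> (\<exists>a b1 b2. split_within_data A a b1 b2 \<and>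
      H1 = A \<inter> {x. a \<bullet> x = b1} \<and> H2 = A \<inter> {x. a \<bullet> x = b2})"

text \<open>(H1,H2) is the split (pi^A(F), pi^A_0(F)) associated with the facet F of K (K \<subseteq> A):
  H1, H2 parallel to F, F between H1 and H2 (possibly on H1, not on H2), and some
  points of K strictly between F and H2.\<close>
definition facet_split :: "(real^'m) set \<Rightarrow> (real^'m) set \<Rightarrow> (real^'m) set \<Rightarrow>
    (real^'m) set \<Rightarrow> (real^'m) set \<Rightarrow> bool" where
  "facet_split A K F H1 H2 \<longleftrightarrow> (\<exists>a b1 b2 c. split_within_data A a b1 b2 \<and>
      H1 = A \<inter> {x. a \<bullet> x = b1} \<and> H2 = A \<inter> {x. a \<bullet> x = b2} \<and>
      (\<forall>x\<in>F. a \<bullet> x = c) \<and> (c = b1 \<or> strictly_between b1 b2 c) \<and>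
      (\<exists>y\<in>K. strictly_between c b2 (a \<bullet> y)))"

definition intersecting_split :: "(real^'m) set \<Rightarrow> (real^'m) set \<Rightarrow> (real^'m) set \<Rightarrow> bool" where
  "intersecting_split K H1 H2 \<longleftrightarrow> H1 \<inter> K \<noteq> {} \<and> H2 \<inter> K \<noteq> {}"

definition two_partitionable :: "(real^'m) set \<Rightarrow> bool" where
  "two_partitionable S \<longleftrightarrow> (\<forall>x\<in>S. \<forall>y\<in>S. x = y) \<or>
     (\<exists>p p0 S1 S2. p \<in> int_points \<and> p \<noteq> 0 \<and> p0 \<in> \<int> \<and>
        S1 \<noteq> {} \<and> S2 \<noteq> {} \<and> S1 \<union> S2 = S \<and> S1 \<inter> S2 = {} \<and>
        S1 \<subseteq> {x. p \<bullet> x = p0} \<and> S2 \<subseteq> {x. p \<bullet> x = p0 + 1})"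

definition integer_hull :: "(real^'m) set \<Rightarrow> (real^'m) set" where
  "integer_hull K = convex hull (K \<inter> int_points)"

definition two_hyperplane_property :: "(real^'m) set \<Rightarrow> bool" where
  "two_hyperplane_property K \<longleftrightarrow>
     (\<forall>G. G face_of integer_hull K \<and> \<not> (\<exists>F. F facet_of K \<and> G \<subseteq> F) \<longrightarrow>
          two_partitionable (G \<inter> int_points))"

end

theory Submission
  imports Defs
begin

text \<open>
  Let \<open>A\<close> be the affine hull of \<open>L\<close>. If \<open>L\<close> lies in a split of \<open>A\<close>, then \<open>L\<close> has the
  2-hyperplane property: a face of the integer hull either meets both boundary hyperplanes or
  lies in a proper face of \<open>L\<close>. This stays true after adding to \<open>L\<close> finitely many
  integer points of the two hyperplanes that affinely span \<open>A\<close>.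

  A relaxation of \<open>L\<close> that gains no integer points and keeps the facets containing integer points
  is still lattice-free and does not change the 2-hyperplane property. So every facet without integer
  points may be traded for slightly tilted hyperplanes that pass through far away integer points of
  \<open>A\<close>; in dimension at least two this can be done so as to cut off the finitely many new integer
  points in a large box, and in dimension one \<open>L\<close> always lies in a split. This gives (i).

  If (ii) failed for a facet whose hyperplane contains integer points, then the relaxed polytope
  would lie in a split of \<open>A\<close> and avoid one of its boundary hyperplanes. This contradicts either
  that \<open>L\<close> lies in no split, or that the integer points added to \<open>L\<close> span \<open>A\<close>.
\<close>

subsection \<open>Integer and rational vectors\<close>

lemma int_points_zero [simp]: "0 \<in> int_points"
  and int_points_add: "x \<in> int_points \<Longrightarrow> y \<in> int_points \<Longrightarrow> x + y \<in> int_points"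
  and int_points_diff: "x \<in> int_points \<Longrightarrow> y \<in> int_points \<Longrightarrow> x - y \<in> int_points"
  and int_points_scaleR: "k \<in> \<int> \<Longrightarrow> x \<in> int_points \<Longrightarrow> k *\<^sub>R x \<in> int_points"
  by (auto simp: int_points_def)

lemma int_points_axis [simp]: "axis i 1 \<in> int_points"
  by (simp add: int_points_def axis_def)

lemma int_points_inner: "x \<in> int_points \<Longrightarrow> y \<in> int_points \<Longrightarrow> x \<bullet> y \<in> \<int>"
  by (auto simp: int_points_def inner_vec_def intro!: Ints_sum Ints_mult)

lemma rat_vec_zero [simp]: "rat_vec 0"
  and rat_vec_add: "rat_vec x \<Longrightarrow> rat_vec y \<Longrightarrow> rat_vec (x + y)"
  and rat_vec_diff: "rat_vec x \<Longrightarrow> rat_vec y \<Longrightarrow> rat_vec (x - y)"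
  and rat_vec_minus: "rat_vec x \<Longrightarrow> rat_vec (- x)"
  and rat_vec_scaleR: "k \<in> \<rat> \<Longrightarrow> rat_vec x \<Longrightarrow> rat_vec (k *\<^sub>R x)"
  by (auto simp: rat_vec_def)

lemma rat_vec_axis [simp]: "rat_vec (axis i 1)"
  by (simp add: rat_vec_def axis_def)

lemma rat_vec_inner: "rat_vec x \<Longrightarrow> rat_vec y \<Longrightarrow> x \<bullet> y \<in> \<rat>"
proof -
  have "(\<Sum>i\<in>I. f i) \<in> \<rat>" if "\<And>i. f i \<in> \<rat>" for f :: "'a \<Rightarrow> real" and I
    using that by (induction I rule: infinite_finite_induct) auto
  then show "rat_vec x \<Longrightarrow> rat_vec y \<Longrightarrow> x \<bullet> y \<in> \<rat>"
    by (simp add: rat_vec_def inner_vec_def)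
qed

lemma int_points_rat_vec: "x \<in> int_points \<Longrightarrow> rat_vec x"
  using Ints_subset_Rats by (auto simp: int_points_def rat_vec_def)

lemma rat_vec_clear_denominators:
  assumes "rat_vec (x :: real^'m)"
  obtains D :: nat where "D > 0" "real D *\<^sub>R x \<in> int_points"
proof -
  have "\<exists>d::nat. d > 0 \<and> real d * x $ i \<in> \<int>" for i
  proof -
    obtain a b :: int where "b > 0" "x $ i = of_int a / of_int b"
      using assms by (meson Rats_cases' rat_vec_def)
    then show ?thesis
      by (intro exI[of _ "nat b"]) auto
  qed
  then obtain d :: "'m \<Rightarrow> nat" where d: "\<And>i. d i > 0" "\<And>i. real (d i) * x $ i \<in> \<int>"
    by metis
  have "real (\<Prod>j\<in>UNIV. d j) * x $ i \<in> \<int>" for i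
  proof -
    have "real (\<Prod>j\<in>UNIV. d j) * x $ i = real (\<Prod>j\<in>UNIV-{i}. d j) * (real (d i) * x $ i)"
      by (simp add: prod.remove[of UNIV i] mult_ac)
    then show ?thesis
      by (metis Ints_mult Ints_of_nat d(2))
  qed
  then show ?thesis
    using d(1) by (intro that[of "\<Prod>j\<in>UNIV. d j"]) (auto simp: int_points_def prod_pos)
qed

lemma rat_vec_dense:
  fixes U :: "(real^'m) set"
  assumes "open U" "x \<in> U"
  obtains y where "y \<in> U" "rat_vec y"
proof -
  obtain e where e: "e > 0" "ball x e \<subseteq> U"
    using assms openE by blast
  obtain a b where ab: "\<forall>i\<in>Basis. a \<bullet> i \<in> \<rat> \<and> b \<bullet> i \<in> \<rat>" "x \<in> box a b" "box a b \<subseteq> ball x e"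
    using rational_boxes[OF e(1)] by blast
  define y where "y = (1/2) *\<^sub>R (a + b)"
  have "a \<bullet> i < b \<bullet> i" if "i \<in> Basis" for i
    using ab(2) that by (force simp: mem_box)
  then have "y \<in> box a b"
    by (auto simp: mem_box y_def inner_add_left)
  moreover have "a $ i \<in> \<rat>" "b $ i \<in> \<rat>" for i
    using ab(1) by (metis axis_in_Basis_iff cart_eq_inner_axis Basis_real_def insertI1)+
  then have "rat_vec y"
    unfolding y_def by (auto simp: rat_vec_def intro!: Rats_mult Rats_add Rats_divide)
  ultimately show ?thesis
    using that ab(3) e(2) by blast
qed

lemma finite_bounded_int_points:
  assumes "bounded (S :: (real^'m) set)"
  shows "finite (S \<inter> int_points)"
proof -
  obtain M where M: "\<And>x. x \<in> S \<Longrightarrow> norm x \<le> M"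
    using assms by (auto simp: bounded_iff)
  let ?I = "{k \<in> \<int>. \<bar>k\<bar> \<le> M}"
  have "S \<inter> int_points \<subseteq> {x. \<forall>i. x $ i \<in> ?I}"
    using M component_le_norm_cart order_trans by (fastforce simp: int_points_def)
  moreover have "finite {x :: real^'m. \<forall>i. x $ i \<in> ?I}"
  proof (rule finite_subset)
    show "{x :: real^'m. \<forall>i. x $ i \<in> ?I} \<subseteq> vec_lambda ` (UNIV \<rightarrow>\<^sub>E ?I)"
      by (auto intro!: image_eqI[of _ _ "vec_nth _"] simp: PiE_def Pi_def)
    show "finite (vec_lambda ` (UNIV \<rightarrow>\<^sub>E ?I) :: (real^'m) set)"
      by (intro finite_imageI finite_PiE finite_abs_int_segment) auto
  qed
  ultimately show ?thesis
    using finite_subset by blast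
qed

subsection \<open>Rational linear systems\<close>

text \<open>Elimination, one generator at a time. If \<open>s\<close> is not yet in the kernel, a
  normal \<open>n0\<close> with \<open>n0 \<bullet> s \<noteq> 0\<close> serves as pivot: every
  normal is corrected by a rational multiple of \<open>n0\<close> to become orthogonal to
  \<open>s\<close>. The pivot itself turns into 0, a vacuous constraint.\<close>

lemma rational_span_eq_kernel:
  fixes S :: "(real^'m) set"
  assumes "finite S" "\<And>s. s \<in> S \<Longrightarrow> rat_vec s"
  shows "\<exists>N. finite N \<and> (\<forall>n\<in>N. rat_vec n) \<and> span S = {x. \<forall>n\<in>N. n \<bullet> x = 0}"
  using assms
proof (induction S rule: finite_induct)
  case empty
  have "x = 0" if "\<forall>i. axis i (1::real) \<bullet> x = 0" for x :: "real^'m"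
    using that by (simp add: vec_eq_iff inner_axis')
  then show ?case
    by (intro exI[of _ "range (\<lambda>i. axis i 1)"]) auto
next
  case (insert s S)
  then obtain N where N: "finite N" "\<And>n. n \<in> N \<Longrightarrow> rat_vec n" "span S = {x. \<forall>n\<in>N. n \<bullet> x = 0}"
    by auto
  show ?case
  proof (cases "\<forall>n\<in>N. n \<bullet> s = 0")
    case True
    then have "s \<in> span S"
      by (simp add: N)
    then have "span (insert s S) = span S"
      by (rule span_redundant)
    with N show ?thesis
      by auto
  next
    case False
    then obtain n0 where n0: "n0 \<in> N" "n0 \<bullet> s \<noteq> 0"
      by blast
    define g where "g n = n - ((n \<bullet> s) / (n0 \<bullet> s)) *\<^sub>R n0" for n
    have "x \<in> span (insert s S) \<longleftrightarrow> (\<forall>n\<in>N. g n \<bullet> x = 0)" for x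
    proof
      assume "x \<in> span (insert s S)"
      then obtain t where t: "x - t *\<^sub>R s \<in> span S"
        by (auto simp: span_insert)
      then have "n \<bullet> x = t * (n \<bullet> s)" if "n \<in> N" for n
        using that by (auto simp: N inner_diff_right)
      then show "\<forall>n\<in>N. g n \<bullet> x = 0"
        using n0 by (auto simp: g_def inner_diff_left)
    next
      assume g0: "\<forall>n\<in>N. g n \<bullet> x = 0"
      have "x - ((n0 \<bullet> x) / (n0 \<bullet> s)) *\<^sub>R s \<in> span S"
        using g0 by (auto simp: N g_def inner_diff_left inner_diff_right)
      then show "x \<in> span (insert s S)"
        by (auto simp: span_insert)
    qed
    moreover have "\<forall>n\<in>N. rat_vec (g n)"
      using N insert.prems n0 by (auto simp: g_def intro!: rat_vec_diff rat_vec_scaleR Rats_divide rat_vec_inner)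
    ultimately show ?thesis
      using N(1) by (intro exI[of _ "g ` N"]) auto
  qed
qed

text \<open>The real solution \<open>v\<close> only certifies consistency; elimination, one equation
  at a time, then yields a rational base point and rational directions.\<close>

lemma rational_system_solution_set:
  fixes E :: "((real^'m) \<times> real) set"
  assumes "finite E" "\<And>g h. (g, h) \<in> E \<Longrightarrow> rat_vec g \<and> h \<in> \<rat>"
    and "\<And>g h. (g, h) \<in> E \<Longrightarrow> g \<bullet> v = h"
  shows "\<exists>x0 S. rat_vec x0 \<and> finite S \<and> (\<forall>s\<in>S. rat_vec s) \<and>
     (\<forall>x. (\<forall>(g, h)\<in>E. g \<bullet> x = h) \<longleftrightarrow> x - x0 \<in> span S)"
  using assms
proof (induction E rule: finite_induct)
  case empty
  have "rat_vec s" if "s \<in> Basis" for s :: "real^'m"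
    using that by (auto simp: Basis_vec_def)
  then show ?case
    by (intro exI[of _ 0] exI[of _ Basis]) (auto simp: span_Basis)
next
  case (insert e E)
  obtain g h where e: "e = (g, h)"
    by force
  have gh: "rat_vec g" "h \<in> \<rat>" "g \<bullet> v = h"
    using insert.prems e by auto
  obtain x0 S where x0: "rat_vec x0" "finite S" "\<And>s. s \<in> S \<Longrightarrow> rat_vec s"
     and sol: "\<And>x. (\<forall>(g, h)\<in>E. g \<bullet> x = h) \<longleftrightarrow> x - x0 \<in> span S"
  proof -
    have "\<exists>x0 S. rat_vec x0 \<and> finite S \<and> (\<forall>s\<in>S. rat_vec s) \<and>
     (\<forall>x. (\<forall>(g, h)\<in>E. g \<bullet> x = h) \<longleftrightarrow> x - x0 \<in> span S)"
      using insert.prems by (intro insert.IH) auto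
    then show ?thesis
      using that by blast
  qed
  have solv: "v - x0 \<in> span S"
    using sol insert.prems by blast
  show ?case
  proof (cases "\<forall>s\<in>S. g \<bullet> s = 0")
    case True
    then have g0: "g \<bullet> y = 0" if "y \<in> span S" for y
      using that by (metis orthogonal_def orthogonal_to_span)
    then have "g \<bullet> x0 = h"
      using g0[OF solv] gh(3) by (simp add: inner_diff_right)
    then have "g \<bullet> x = h" if "x - x0 \<in> span S" for x
      using g0[OF that] by (auto simp: inner_diff_right)
    then have "(\<forall>(g, h)\<in>insert e E. g \<bullet> x = h) \<longleftrightarrow> x - x0 \<in> span S" for x
      using sol[of x] e by auto
    with x0 show ?thesis
      by blast
  next
    case False
    then obtain s0 where s0: "s0 \<in> S" "g \<bullet> s0 \<noteq> 0"
      by blast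
    \<comment> \<open>\<open>k\<close> projects along \<open>s0\<close> onto the kernel of
      \<open>g\<close>, and \<open>x1\<close> is \<open>x0\<close> moved along \<open>s0\<close>
      until the new equation holds.\<close>
    define k where "k s = s - ((g \<bullet> s) / (g \<bullet> s0)) *\<^sub>R s0" for s
    define x1 where "x1 = x0 + ((h - g \<bullet> x0) / (g \<bullet> s0)) *\<^sub>R s0"
    have lin: "linear k"
      unfolding k_def by (rule linearI) (auto simp: algebra_simps inner_add_right add_divide_distrib)
    have spank: "span (k ` S) = k ` span S"
      using lin by (simp add: linear_span_image)
    have gk: "g \<bullet> k s = 0" for s
      using s0 by (simp add: k_def inner_diff_right)
    have gx1: "g \<bullet> x1 = h"
      using s0 by (simp add: x1_def inner_add_right)
    have kS: "k s \<in> span S" if "s \<in> span S" for s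
      unfolding k_def using that s0 span_base by (intro span_diff span_scale) auto
    have x10: "x1 - x0 \<in> span S"
      by (simp add: x1_def span_scale[OF span_base[OF s0(1)]])
    have "(\<forall>(g, h)\<in>insert e E. g \<bullet> x = h) \<longleftrightarrow> x - x1 \<in> span (k ` S)" for x
    proof
      assume L: "\<forall>(g, h)\<in>insert e E. g \<bullet> x = h"
      then have "x - x0 \<in> span S" "g \<bullet> x = h"
        using sol e by auto
      then have "x - x1 \<in> span S"
        using x10 span_diff by fastforce
      moreover have "k (x - x1) = x - x1"
        using \<open>g \<bullet> x = h\<close> gx1 by (simp add: k_def inner_diff_right)
      ultimately show "x - x1 \<in> span (k ` S)"
        unfolding spank by (metis imageI)
    next
      assume "x - x1 \<in> span (k ` S)"
      then obtain y where y: "y \<in> span S" "x - x1 = k y"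
        unfolding spank by blast
      then have "x - x0 \<in> span S"
        using span_add[OF kS[OF y(1)] x10] by (simp flip: y(2))
      moreover have "g \<bullet> x = h"
        using gx1 gk[of y] y(2) by (metis diff_add_cancel inner_add_right add_0)
      ultimately show "\<forall>(g, h)\<in>insert e E. g \<bullet> x = h"
        using sol e by auto
    qed
    moreover have "rat_vec x1" "\<forall>s\<in>k ` S. rat_vec s"
      using x0 gh s0 by (auto simp: x1_def k_def intro!: rat_vec_add rat_vec_diff rat_vec_scaleR Rats_divide Rats_diff rat_vec_inner)
    ultimately show ?thesis
      using x0(2) by blast
  qed
qed

text \<open>\<open>P\<close> is the hull of its finitely many extreme points, so these have to be
  rational. The equations tight at an extreme point \<open>v\<close> have a rational solution
  \<open>x0\<close>; moving from \<open>v\<close> a little along \<open>x0 - v\<close> in either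
  direction stays in \<open>P\<close>, so extremality forces \<open>x0 = v\<close>.\<close>

lemma rational_polytope_if_bounded_rational_system:
  fixes E :: "((real^'m) \<times> real) set"
  assumes fin: "finite E" and rat: "\<And>g h. (g, h) \<in> E \<Longrightarrow> rat_vec g \<and> h \<in> \<rat>"
    and P: "P = {x. \<forall>(g, h)\<in>E. g \<bullet> x \<le> h}" and bnd: "bounded P"
  shows "rational_polytope P"
proof -
  have "P = \<Inter> ((\<lambda>(g, h). {x. g \<bullet> x \<le> h}) ` E)"
    unfolding P by auto
  moreover have "polyhedron (\<Inter> ((\<lambda>(g, h). {x. g \<bullet> x \<le> h}) ` E))"
    using fin by (intro polyhedron_Inter) (auto simp: polyhedron_halfspace_le)
  ultimately have poly: "polyhedron P"
    by simp
  have "rat_vec v" if v: "v extreme_point_of P" for v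
  proof -
    have vP: "v \<in> P"
      using v by (simp add: extreme_point_of_def)
    define T where "T = {(g, h) \<in> E. g \<bullet> v = h}"
    have T: "finite T" "T \<subseteq> E"
      using fin by (auto simp: T_def intro: finite_subset[of _ E])
    have "\<exists>x0 S. rat_vec x0 \<and> finite S \<and> (\<forall>s\<in>S. rat_vec s) \<and>
     (\<forall>x. (\<forall>(g, h)\<in>T. g \<bullet> x = h) \<longleftrightarrow> x - x0 \<in> span S)"
      by (rule rational_system_solution_set[of T v]) (use T rat in \<open>auto simp: T_def\<close>)
    then obtain x0 S where "rat_vec x0" and sol: "\<And>x. (\<forall>(g, h)\<in>T. g \<bullet> x = h) \<longleftrightarrow> x - x0 \<in> span S"
      by blast
    define d where "d = x0 - v"
    have "\<forall>(g, h)\<in>T. g \<bullet> x0 = h"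
      by (simp add: sol span_zero)
    then have act: "g \<bullet> d = 0" if "(g, h) \<in> E" "g \<bullet> v = h" for g h
      using that by (auto simp: T_def d_def inner_diff_right)
    \<comment> \<open>Tight constraints do not change along \<open>d\<close>, slack ones survive
      small moves by continuity, and finiteness of \<open>E\<close> gives a common step
      length.\<close>
    have "eventually (\<lambda>e. \<forall>p\<in>E. fst p \<bullet> (v + e *\<^sub>R d) \<le> snd p \<and> fst p \<bullet> (v - e *\<^sub>R d) \<le> snd p) (at_right 0)"
      unfolding eventually_ball_finite_distrib[OF fin]
    proof
      fix p assume p: "p \<in> E"
      obtain g h where gh: "p = (g, h)"
        by force
      show "eventually (\<lambda>e. fst p \<bullet> (v + e *\<^sub>R d) \<le> snd p \<and> fst p \<bullet> (v - e *\<^sub>R d) \<le> snd p) (at_right 0)"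
      proof (cases "g \<bullet> v = h")
        case True
        then show ?thesis
          using act[of g h] p gh by (simp add: inner_add_right inner_diff_right)
      next
        case False
        then have less: "g \<bullet> v < h"
          using vP p gh by (force simp: P)
        have "((\<lambda>e. g \<bullet> (v + e *\<^sub>R d)) \<longlongrightarrow> g \<bullet> (v + 0 *\<^sub>R d)) (at_right 0)"
          "((\<lambda>e. g \<bullet> (v - e *\<^sub>R d)) \<longlongrightarrow> g \<bullet> (v - 0 *\<^sub>R d)) (at_right 0)"
          by (intro tendsto_intros)+
        then have "eventually (\<lambda>e. g \<bullet> (v + e *\<^sub>R d) < h) (at_right 0)"
          "eventually (\<lambda>e. g \<bullet> (v - e *\<^sub>R d) < h) (at_right 0)"
          using less by (auto intro: order_tendstoD(2))
        then show ?thesis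
          by eventually_elim (simp add: gh)
      qed
    qed
    then have "eventually (\<lambda>e. v + e *\<^sub>R d \<in> P \<and> v - e *\<^sub>R d \<in> P \<and> e > 0) (at_right 0)"
      using eventually_at_right_less[of "0::real"] by eventually_elim (force simp: P)
    then obtain e :: real where e: "v + e *\<^sub>R d \<in> P" "v - e *\<^sub>R d \<in> P" "e > 0"
      using eventually_happens trivial_limit_at_right_real by blast
    have "d = 0"
    proof (rule ccontr)
      assume "d \<noteq> 0"
      have "v = midpoint (v + e *\<^sub>R d) (v - e *\<^sub>R d)"
        by (simp add: midpoint_def)
      moreover have "v + e *\<^sub>R d \<noteq> v - e *\<^sub>R d"
      proof
        assume "v + e *\<^sub>R d = v - e *\<^sub>R d"
        then have "(2 * e) *\<^sub>R d = 0"
          by (simp add: algebra_simps flip: scaleR_add_left)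
        then show False
          using \<open>d \<noteq> 0\<close> e(3) by simp
      qed
      ultimately have "v \<in> open_segment (v + e *\<^sub>R d) (v - e *\<^sub>R d)"
        by (metis midpoint_in_open_segment)
      then show False
        using v e by (auto simp: extreme_point_of_def)
    qed
    then show ?thesis
      using \<open>rat_vec x0\<close> by (simp add: d_def)
  qed
  moreover have "finite {v. v extreme_point_of P}"
    using poly by (rule finite_polyhedron_extreme_points)
  moreover have "P = convex hull {v. v extreme_point_of P}"
    using poly bnd by (intro Krein_Milman_Minkowski)
      (auto simp: polyhedron_imp_convex polyhedron_imp_closed compact_eq_bounded_closed)
  ultimately show ?thesis
    unfolding rational_polytope_def by blast
qed

lemma rational_polytope_imp_polytope: "rational_polytope K \<Longrightarrow> polytope K"
  by (auto simp: rational_polytope_def polytope_def)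

text \<open>Adding a multiple of one normal \<open>n\<close> makes the functional vanish on a vector of minimal
  positive \<open>n\<close>-value, which removes \<open>n\<close> from the list of constraints.\<close>

lemma integral_functional_extends:
  fixes N :: "(real^'m) set"
  assumes "finite N" "N \<subseteq> int_points"
    and "\<And>z. z \<in> int_points \<Longrightarrow> \<forall>n\<in>N. n \<bullet> z = 0 \<Longrightarrow> a \<bullet> z \<in> \<int>"
  shows "\<exists>p\<in>int_points. \<forall>x. (\<forall>n\<in>N. n \<bullet> x = 0) \<longrightarrow> p \<bullet> x = a \<bullet> x"
  using assms
proof (induction N arbitrary: a rule: finite_induct)
  case empty
  have "a $ i \<in> \<int>" for i
    using empty(2)[of "axis i 1"] by (simp add: inner_axis)
  then have "a \<in> int_points"
    by (simp add: int_points_def)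
  then show ?case
    by blast
next
  case (insert n N a)
  define M where "M = {z \<in> int_points. \<forall>n\<in>N. n \<bullet> z = 0}"
  have n: "n \<in> int_points"
    using insert.prems by auto
  have M: "0 \<in> M" "\<And>x y k. x \<in> M \<Longrightarrow> y \<in> M \<Longrightarrow> k \<in> \<int> \<Longrightarrow> x + k *\<^sub>R y \<in> M"
    by (auto simp: M_def inner_add_right intro!: int_points_add int_points_scaleR)
  show ?case
  proof (cases "\<forall>z\<in>M. n \<bullet> z = 0")
    \<comment> \<open>Here \<open>n\<close> imposes nothing on integer points beyond
      \<open>N\<close>, so the integrality hypothesis already holds for \<open>N\<close>
      alone.\<close>
    case True
    have "\<exists>p\<in>int_points. \<forall>x. (\<forall>n\<in>N. n \<bullet> x = 0) \<longrightarrow> p \<bullet> x = a \<bullet> x"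
    proof (rule insert.IH)
      fix z :: "real^'m" assume "z \<in> int_points" "\<forall>n\<in>N. n \<bullet> z = 0"
      then show "a \<bullet> z \<in> \<int>"
        using insert.prems(2) True by (auto simp: M_def)
    qed (use insert.prems in auto)
    then show ?thesis
      by auto
  next
    case False
    then obtain w0 where w0: "w0 \<in> M" "n \<bullet> w0 \<noteq> 0"
      by blast
    have "\<exists>k::nat. k > 0 \<and> (\<exists>w\<in>M. n \<bullet> w = real k)"
    proof -
      have "n \<bullet> w0 \<in> \<int>"
        using w0 n by (auto simp: M_def int_points_inner)
      then obtain j :: int where j: "n \<bullet> w0 = of_int j"
        by (auto elim: Ints_cases)
      have "of_int (sgn j) *\<^sub>R w0 \<in> M" "n \<bullet> (of_int (sgn j) *\<^sub>R w0) = real (nat \<bar>j\<bar>)"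
        using M(2)[OF M(1) w0(1), of "of_int (sgn j)"] j by (auto simp: sgn_if)
      moreover have "nat \<bar>j\<bar> > 0"
        using j w0 by auto
      ultimately show ?thesis
        by blast
    qed
    then obtain k :: nat where k: "k > 0" "\<exists>w\<in>M. n \<bullet> w = real k"
      and kmin: "\<And>j. 0 < j \<Longrightarrow> j < k \<Longrightarrow> \<not> (\<exists>w\<in>M. n \<bullet> w = real j)"
      using exists_least_iff[of "\<lambda>k. k > 0 \<and> (\<exists>w\<in>M. n \<bullet> w = real k)"] by auto
    then obtain w where w: "w \<in> M" "n \<bullet> w = real k"
      by blast
    define a' where "a' = a - ((a \<bullet> w) / real k) *\<^sub>R n"
    have a'w: "a' \<bullet> w = 0"
      using w k by (simp add: a'_def inner_diff_left)
    have "\<exists>p\<in>int_points. \<forall>x. (\<forall>n\<in>N. n \<bullet> x = 0) \<longrightarrow> p \<bullet> x = a' \<bullet> x"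
    proof (rule insert.IH)
      fix z :: "real^'m" assume z: "z \<in> int_points" "\<forall>n\<in>N. n \<bullet> z = 0"
      then obtain j :: int where j: "n \<bullet> z = of_int j"
        using int_points_inner[OF n z(1)] by (auto elim: Ints_cases)
      \<comment> \<open>Division with remainder: \<open>y\<close> has \<open>n\<close>-value
        \<open>j mod k\<close>, and minimality of \<open>k\<close> among the positive values on
        \<open>M\<close> forces the remainder to be 0.\<close>
      define q where "q = j div int k"
      define y where "y = z + (- of_int q) *\<^sub>R w"
      have yM: "y \<in> M"
        unfolding y_def using z w by (intro M) (auto simp: M_def)
      have ny: "n \<bullet> y = of_int (j mod int k)"
        using j w by (simp add: y_def inner_diff_right q_def minus_div_mult_eq_mod[symmetric])
      have "j mod int k = 0"
      proof (rule ccontr)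
        assume "j mod int k \<noteq> 0"
        then have "0 < nat (j mod int k)" "nat (j mod int k) < k"
          using k(1) pos_mod_sign[of "int k" j] pos_mod_bound[of "int k" j] by linarith+
        moreover have "n \<bullet> y = real (nat (j mod int k))"
          using ny k by simp
        ultimately show False
          using kmin yM by blast
      qed
      then have ny0: "n \<bullet> y = 0"
        using ny by simp
      then have "a \<bullet> y \<in> \<int>"
        using insert.prems(2) yM by (auto simp: M_def)
      moreover have "a' \<bullet> z = a \<bullet> y"
      proof -
        have "a' \<bullet> z = a' \<bullet> y"
          using a'w by (simp add: y_def inner_diff_right)
        also have "\<dots> = a \<bullet> y"
          using ny0 by (simp add: a'_def inner_diff_left)
        finally show ?thesis .
      qed
      ultimately show "a' \<bullet> z \<in> \<int>"
        by simp
    qed (use insert.prems in auto)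
    then obtain p where "p \<in> int_points" "\<And>x. (\<forall>n\<in>N. n \<bullet> x = 0) \<Longrightarrow> p \<bullet> x = a' \<bullet> x"
      by blast
    then show ?thesis
      by (intro bexI[of _ p]) (auto simp: a'_def inner_diff_left)
  qed
qed

subsection \<open>Facets and supporting hyperplanes\<close>

text \<open>Since \<open>a\<close> is not constant on the affine hull, the hyperplane section has
  codimension one there, the same dimension as the facet it contains. If \<open>K\<close> had points
  on both sides, a segment joining them would meet \<open>F\<close> in an inner point, and the face
  property would pull its ends into \<open>F\<close>.\<close>

lemma facet_hyperplane:
  fixes K :: "(real^'m) set"
  assumes "convex K" "F facet_of K" "\<And>x. x \<in> F \<Longrightarrow> a \<bullet> x = c"
    and "\<exists>x\<in>affine hull K. \<exists>y\<in>affine hull K. a \<bullet> x \<noteq> a \<bullet> y"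
  shows "affine hull F = affine hull K \<inter> {x. a \<bullet> x = c}"
    and "F = K \<inter> {x. a \<bullet> x = c}"
    and "(\<forall>x\<in>K. a \<bullet> x \<le> c) \<or> (\<forall>x\<in>K. a \<bullet> x \<ge> c)"
proof -
  have F: "F face_of K" "F \<noteq> {}" "aff_dim F = aff_dim K - 1"
    using assms(2) by (auto simp: facet_of_def)
  let ?H = "affine hull K \<inter> {x. a \<bullet> x = c}"
  have aff: "affine ?H"
    by (intro affine_Int affine_affine_hull affine_hyperplane)
  have sub: "F \<subseteq> ?H"
    using assms(3) face_of_imp_subset[OF F(1)] hull_subset[of K affine] by blast
  have "aff_dim ?H = aff_dim K - 1"
  proof -
    have "?H \<noteq> {}"
      using sub F(2) by blast
    moreover have "\<not> affine hull K \<subseteq> {x. a \<bullet> x = c}"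
      using assms(4) by (metis (mono_tags) mem_Collect_eq subsetD)
    ultimately show ?thesis
      by (simp add: aff_dim_affine_Int_hyperplane)
  qed
  then have "aff_dim (affine hull F) = aff_dim ?H"
    using F(3) by (simp add: aff_dim_affine_hull)
  then show eq: "affine hull F = ?H"
    using aff F(2) hull_minimal[OF sub, of affine] affine_dim_equal[of "affine hull F" ?H] by simp
  have Feq: "F = affine hull F \<inter> K"
    using face_of_imp_eq_affine_Int[OF assms(1) F(1)] .
  then show Feq': "F = K \<inter> {x. a \<bullet> x = c}"
    using eq hull_subset[of K affine] by blast
  show "(\<forall>x\<in>K. a \<bullet> x \<le> c) \<or> (\<forall>x\<in>K. a \<bullet> x \<ge> c)"
  proof (rule ccontr)
    assume "\<not> ?thesis"
    then obtain x y where xy: "x \<in> K" "y \<in> K" "a \<bullet> x > c" "a \<bullet> y < c"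
      by force
    have "connected (closed_segment y x)" 
      by simp
    then obtain w where w: "w \<in> closed_segment y x" "a \<bullet> w = c"
      using connected_ivt_hyperplane[of "closed_segment y x" y x a c] xy by auto
    have "w \<in> K"
      using w(1) xy assms(1) closed_segment_subset by blast
    then have "w \<in> F"
      using Feq' w(2) by blast
    moreover have "w \<in> open_segment y x"
      using w xy by (auto simp: open_segment_def)
    ultimately have "x \<in> F"
      using F(1) xy by (auto simp: face_of_def)
    then show False
      using assms(3) xy by auto
  qed
qed

text \<open>\<open>F\<close> is the hull of some of the rational generators of \<open>K\<close>, so
  its direction space is cut out by rational normals. One of these does not vanish on
  \<open>x - f\<close> for a point \<open>x\<close> of \<open>K\<close> outside \<open>F\<close>; up
  to sign it is the required normal.\<close>

lemma facet_rational_normal: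
  fixes K :: "(real^'m) set"
  assumes "rational_polytope K" "F facet_of K"
  obtains a c where "rat_vec a" "\<And>x. x \<in> K \<Longrightarrow> a \<bullet> x \<le> c" "F = K \<inter> {x. a \<bullet> x = c}"
    "\<exists>x\<in>K. \<exists>y\<in>K. a \<bullet> x \<noteq> a \<bullet> y"
proof -
  obtain S where S: "finite S" "\<And>x. x \<in> S \<Longrightarrow> rat_vec x" "K = convex hull S"
    using assms(1) by (auto simp: rational_polytope_def)
  have conv: "convex K"
    using S by simp
  have F: "F face_of K" "F \<noteq> {}" "aff_dim F = aff_dim K - 1"
    using assms(2) by (auto simp: facet_of_def)
  obtain T where T: "T \<subseteq> S" "F = convex hull T"
    using F(1) S face_of_convex_hull_subset[of S F] finite_imp_compact by metis
  then obtain f where f: "f \<in> T"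
    using F(2) by fastforce
  have hullF: "affine hull F = (\<lambda>x. f + x) ` span ((\<lambda>x. - f + x) ` T)"
    using affine_hull_span_gen[of f T] f T by (simp add: hull_inc)
  have "finite T" "\<And>t. t \<in> T \<Longrightarrow> rat_vec t"
    using T(1) S finite_subset by blast+
  then have "\<exists>N. finite N \<and> (\<forall>n\<in>N. rat_vec n) \<and> span ((\<lambda>x. - f + x) ` T) = {x. \<forall>n\<in>N. n \<bullet> x = 0}"
    using f by (intro rational_span_eq_kernel) (auto intro!: rat_vec_diff)
  then obtain N where N: "\<forall>n\<in>N. rat_vec n" "span ((\<lambda>x. - f + x) ` T) = {x. \<forall>n\<in>N. n \<bullet> x = 0}"
    by blast
  have "F \<noteq> K"
    using F(3) by auto
  then obtain x where x: "x \<in> K" "x \<notin> F"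
    using F(1) face_of_imp_subset by blast
  then have "x \<notin> affine hull F"
    using face_of_imp_eq_affine_Int[OF conv F(1)] by blast
  moreover have "x = f + (x - f)"
    by simp
  ultimately have "x - f \<notin> span ((\<lambda>x. - f + x) ` T)"
    unfolding hullF by blast
  then obtain n where n: "n \<in> N" "n \<bullet> (x - f) \<noteq> 0"
    using N(2) by auto
  have nF: "n \<bullet> y = n \<bullet> f" if "y \<in> F" for y
  proof -
    have "y \<in> affine hull F"
      using that by (simp add: hull_inc)
    then show ?thesis
      using n(1) unfolding hullF N(2) by (auto simp: inner_add_right)
  qed
  have fK: "f \<in> K"
    using f T(1) S(3) by (auto intro: hull_inc)
  then have nc: "\<exists>x\<in>K. \<exists>y\<in>K. n \<bullet> x \<noteq> n \<bullet> y"
    using n(2) x(1) by (auto simp: inner_diff_right)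
  then have "\<exists>x\<in>affine hull K. \<exists>y\<in>affine hull K. n \<bullet> x \<noteq> n \<bullet> y"
    by (meson hull_inc)
  note fh = facet_hyperplane[OF conv assms(2) nF this]
  from fh(3) show thesis
  proof
    assume "\<forall>x\<in>K. n \<bullet> x \<le> n \<bullet> f"
    then show thesis
      using that[of n "n \<bullet> f"] fh(2) N(1) n(1) nc by blast
  next
    assume "\<forall>x\<in>K. n \<bullet> f \<le> n \<bullet> x"
    moreover have "F = K \<inter> {x. - n \<bullet> x = - n \<bullet> f}"
      using fh(2) by simp
    moreover have "\<exists>x\<in>K. \<exists>y\<in>K. - n \<bullet> x \<noteq> - n \<bullet> y"
      using nc by simp
    ultimately show thesis
      using that[of "- n" "- n \<bullet> f"] N(1) n(1) rat_vec_minus by auto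
  qed
qed

text \<open>The maximizers form a face; a face that meets the relative interior is all of
  \<open>K\<close>, and constancy passes to the affine hull.\<close>

lemma linear_max_at_rel_interior_imp_constant:
  fixes K :: "(real^'m) set"
  assumes "convex K" "r \<in> rel_interior K" "\<And>x. x \<in> K \<Longrightarrow> a \<bullet> x \<le> a \<bullet> r" "x \<in> affine hull K"
  shows "a \<bullet> x = a \<bullet> r"
proof -
  have "K \<inter> {x. a \<bullet> x = a \<bullet> r} face_of K"
    using assms by (intro face_of_Int_supporting_hyperplane_le) auto
  then have "K \<subseteq> K \<inter> {x. a \<bullet> x = a \<bullet> r}"
    using assms(2) rel_interior_subset[of K] by (auto dest: subset_of_face_of[of _ K K])
  then have "affine hull K \<subseteq> {x. a \<bullet> x = a \<bullet> r}"
    by (intro hull_minimal affine_hyperplane) auto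
  then show ?thesis
    using assms(4) by blast
qed

lemma split_within_data_swap: "split_within_data A a b1 b2 \<longleftrightarrow> split_within_data A a b2 b1"
  unfolding split_within_data_def strictly_between_def by auto

text \<open>Boundedness makes \<open>integer_hull K\<close> the hull of finitely many integer
  points, and each face is the hull of some of these.\<close>

lemma face_of_integer_hull:
  assumes "bounded K" "G face_of integer_hull K"
  shows "G = convex hull (G \<inter> int_points)"
proof -
  have "compact (K \<inter> int_points)"
    using assms(1) finite_bounded_int_points finite_imp_compact by blast
  then obtain T where T: "T \<subseteq> K \<inter> int_points" "G = convex hull T"
    using assms(2) face_of_convex_hull_subset unfolding integer_hull_def by blast
  then have "T \<subseteq> G \<inter> int_points"
    by (auto simp: hull_inc)
  then have "convex hull T \<subseteq> convex hull (G \<inter> int_points)"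
    by (rule hull_mono)
  moreover have "convex hull (G \<inter> int_points) \<subseteq> G"
    using T(2) by (intro hull_minimal) auto
  ultimately show ?thesis
    using T(2) by blast
qed

lemma integer_hull_subset: "convex K \<Longrightarrow> integer_hull K \<subseteq> K"
  unfolding integer_hull_def by (rule hull_minimal[of _ _ convex]) simp_all

subsection \<open>Lattice flats\<close>

text \<open>The affine lattice subspace \<open>A\<close>, given by an integer base point and a
  finite set of integer vectors spanning its directions over the reals. \<open>B\<close> is a
  spanning set and not a basis of the lattice, so clearing denominators suffices to obtain
  it.\<close>

locale lattice_flat =
  fixes A :: "(real^'m) set" and z0 :: "real^'m" and B :: "(real^'m) set"
  assumes finite_B: "finite B" and B_int: "B \<subseteq> int_points" and z0_int: "z0 \<in> int_points"
    and A_eq: "A = {x. x - z0 \<in> span B}"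
begin

lemma z0_in: "z0 \<in> A"
  by (simp add: A_eq span_zero)

lemma add_in: "x \<in> A \<Longrightarrow> v \<in> span B \<Longrightarrow> x + v \<in> A"
  using span_add[of "x - z0" B v] by (simp add: A_eq algebra_simps)

lemma diff_in: "x \<in> A \<Longrightarrow> y \<in> A \<Longrightarrow> x - y \<in> span B"
  using span_diff[of "x - z0" B "y - z0"] by (simp add: A_eq)

lemma A_image: "A = (+) z0 ` span B"
proof -
  have "x \<in> (+) z0 ` span B" if "x - z0 \<in> span B" for x
    using that by (intro image_eqI[of _ _ "x - z0"]) auto
  then show ?thesis
    by (auto simp: A_eq)
qed

lemma affine_A: "affine A"
  unfolding A_image by (simp add: affine_translation[symmetric] subspace_imp_affine)

lemma nonconstant_iff: "(\<exists>x\<in>A. \<exists>y\<in>A. a \<bullet> x \<noteq> a \<bullet> y) \<longleftrightarrow> (\<exists>b\<in>B. a \<bullet> b \<noteq> 0)"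
proof
  assume "\<exists>x\<in>A. \<exists>y\<in>A. a \<bullet> x \<noteq> a \<bullet> y"
  then obtain x y where xy: "x \<in> A" "y \<in> A" "a \<bullet> (x - y) \<noteq> 0"
    by (auto simp: inner_diff_right)
  show "\<exists>b\<in>B. a \<bullet> b \<noteq> 0"
  proof (rule ccontr)
    assume "\<not> ?thesis"
    then have "a \<bullet> v = 0" if "v \<in> span B" for v
      using that by (metis orthogonal_def orthogonal_to_span)
    then show False
      using xy diff_in by blast
  qed
next
  assume "\<exists>b\<in>B. a \<bullet> b \<noteq> 0"
  then obtain b where b: "b \<in> B" "a \<bullet> b \<noteq> 0"
    by blast
  then have "z0 + b \<in> A" "a \<bullet> (z0 + b) \<noteq> a \<bullet> z0"
    using z0_in add_in span_base by (auto simp: inner_add_right)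
  then show "\<exists>x\<in>A. \<exists>y\<in>A. a \<bullet> x \<noteq> a \<bullet> y"
    using z0_in by blast
qed

text \<open>With \<open>D\<close> a common denominator of \<open>a\<close>, the values of
  \<open>a\<close> at integer points are multiples of \<open>1/D\<close>, so among those below
  \<open>r\<close> there is a largest one. It supplies the neighbouring hyperplane of a
  split.\<close>

lemma lattice_value_below:
  assumes "rat_vec a" "\<exists>b\<in>B. a \<bullet> b \<noteq> 0"
  obtains z where "z \<in> A" "z \<in> int_points" "a \<bullet> z < r"
    "\<And>w. w \<in> A \<Longrightarrow> w \<in> int_points \<Longrightarrow> a \<bullet> w < r \<Longrightarrow> a \<bullet> w \<le> a \<bullet> z"
proof -
  obtain D :: nat where D: "D > 0" "real D *\<^sub>R a \<in> int_points"
    using assms(1) rat_vec_clear_denominators by blast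
  obtain b where b: "b \<in> B" "a \<bullet> b \<noteq> 0"
    using assms(2) by blast
  \<comment> \<open>Enough downward steps of size \<open>|a \<bullet> b|\<close> to get from the
    value at \<open>z0\<close> to below \<open>r\<close>.\<close>
  define k where "k = \<lfloor>(a \<bullet> z0 - r) / \<bar>a \<bullet> b\<bar>\<rfloor> + 1"
  have "(a \<bullet> z0 - r) / \<bar>a \<bullet> b\<bar> < of_int k"
    unfolding k_def by linarith
  then have k: "a \<bullet> z0 - r < of_int k * \<bar>a \<bullet> b\<bar>"
    using b(2) by (simp add: pos_divide_less_eq)
  define w0 where "w0 = z0 + (- of_int k * sgn (a \<bullet> b)) *\<^sub>R b"
  have "w0 \<in> A"
    unfolding w0_def using z0_in b(1) by (intro add_in span_scale span_base)
  moreover have "w0 \<in> int_points"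
    unfolding w0_def using z0_int b(1) B_int
    by (intro int_points_add int_points_scaleR Ints_mult Ints_minus) (auto simp: sgn_if)
  moreover have "a \<bullet> w0 < r"
    using k by (simp add: w0_def inner_diff_right abs_sgn algebra_simps)
  ultimately have ex: "w0 \<in> A \<and> w0 \<in> int_points \<and> a \<bullet> w0 < r"
    by blast
  \<comment> \<open>A natural number that decreases as \<open>a \<bullet> w\<close> grows. For
    values below \<open>r\<close> the difference is nonnegative, so \<open>nat\<close> truncates
    nothing.\<close>
  define f where "f w = nat (\<lceil>real D * r\<rceil> - \<lfloor>real D * (a \<bullet> w)\<rfloor>)" for w
  obtain z where z: "z \<in> A" "z \<in> int_points" "a \<bullet> z < r"
    and least: "\<And>w. w \<in> A \<Longrightarrow> w \<in> int_points \<Longrightarrow> a \<bullet> w < r \<Longrightarrow> f z \<le> f w"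
    using ex_has_least_nat[of "\<lambda>w. w \<in> A \<and> w \<in> int_points \<and> a \<bullet> w < r" w0 f] ex by blast
  have "a \<bullet> w \<le> a \<bullet> z" if w: "w \<in> A" "w \<in> int_points" "a \<bullet> w < r" for w
  proof -
    have i: "real D * (a \<bullet> x) = of_int \<lfloor>real D * (a \<bullet> x)\<rfloor>" if "x \<in> int_points" for x
      using int_points_inner[OF D(2) that] by simp
    have "real D * (a \<bullet> w) < real D * r"
      using w(3) D(1) by simp
    then have "\<lfloor>real D * (a \<bullet> w)\<rfloor> \<le> \<lceil>real D * r\<rceil>"
      by linarith
    then have "\<lfloor>real D * (a \<bullet> w)\<rfloor> \<le> \<lfloor>real D * (a \<bullet> z)\<rfloor>"
      using least[OF w] by (auto simp: f_def)
    then have "real D * (a \<bullet> w) \<le> real D * (a \<bullet> z)"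
      using i[OF w(2)] i[OF z(2)] by (metis of_int_le_iff)
    then show ?thesis
      using D(1) by simp
  qed
  then show thesis
    using that z by blast
qed

lemma lattice_value_above:
  assumes "rat_vec a" "\<exists>b\<in>B. a \<bullet> b \<noteq> 0"
  obtains z where "z \<in> A" "z \<in> int_points" "a \<bullet> z > r"
    "\<And>w. w \<in> A \<Longrightarrow> w \<in> int_points \<Longrightarrow> a \<bullet> w > r \<Longrightarrow> a \<bullet> w \<ge> a \<bullet> z"
proof (rule lattice_value_below[of "- a" "- r"])
  fix z assume "z \<in> A" "z \<in> int_points" "- a \<bullet> z < - r"
    "\<And>w. w \<in> A \<Longrightarrow> w \<in> int_points \<Longrightarrow> - a \<bullet> w < - r \<Longrightarrow> - a \<bullet> w \<le> - a \<bullet> z"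
  then show thesis
    by (intro that[of z]) auto
qed (use assms in \<open>auto simp: rat_vec_minus\<close>)

section \<open>Integrality of splits within the flat\<close>

text \<open>Let \<open>q\<close> be the quotient. Subtracting its integer part times
  \<open>h2 - h1\<close> from \<open>z\<close> and adding \<open>h1\<close> gives an integer point
  of \<open>A\<close> whose value lies at the fraction \<open>frac q\<close> of the way from
  \<open>b1\<close> to \<open>b2\<close>. No integer point lies strictly inside the split, so the
  fraction is 0.\<close>

lemma split_integral:
  assumes "split_within_data A a b1 b2" "z \<in> span B" "z \<in> int_points"
  shows "(a \<bullet> z) / (b2 - b1) \<in> \<int>"
proof -
  obtain h1 h2 where h: "h1 \<in> A" "h1 \<in> int_points" "a \<bullet> h1 = b1" "h2 \<in> A" "h2 \<in> int_points" "a \<bullet> h2 = b2"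
    and ne: "b1 \<noteq> b2" and no: "\<And>w. w \<in> A \<Longrightarrow> w \<in> int_points \<Longrightarrow> \<not> strictly_between b1 b2 (a \<bullet> w)"
    using assms(1) unfolding split_within_data_def by blast
  define q where "q = (a \<bullet> z) / (b2 - b1)"
  define w where "w = h1 + (z - of_int \<lfloor>q\<rfloor> *\<^sub>R (h2 - h1))"
  have w: "w \<in> A" "w \<in> int_points"
    unfolding w_def using h(2,5) assms(3) diff_in[OF h(4,1)]
    by (intro add_in[OF h(1)] span_diff[OF assms(2)] span_scale int_points_add int_points_diff int_points_scaleR;
        simp)+
  have "a \<bullet> z = q * (b2 - b1)"
    using ne by (simp add: q_def)
  then have aw: "a \<bullet> w = b1 + frac q * (b2 - b1)"
    by (simp add: w_def inner_add_right inner_diff_right h frac_def algebra_simps)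
  have "frac q = 0"
  proof (rule ccontr)
    assume "frac q \<noteq> 0"
    then have f: "0 < frac q" "frac q < 1"
      using frac_ge_0[of q] frac_lt_1[of q] by linarith+
    have "strictly_between b1 b2 (a \<bullet> w)"
    proof (cases "b1 < b2")
      case True
      then have "0 < frac q * (b2 - b1)" "frac q * (b2 - b1) < 1 * (b2 - b1)"
        using f by (auto intro: mult_strict_right_mono simp del: mult_1)
      then show ?thesis
        by (simp add: strictly_between_def aw)
    next
      case False
      then have "0 < frac q * (b1 - b2)" "frac q * (b1 - b2) < 1 * (b1 - b2)"
        using f ne by (auto intro: mult_strict_right_mono simp del: mult_1)
      then show ?thesis
        by (simp add: strictly_between_def aw algebra_simps)
    qed
    then show False
      using no w by blast
  qed
  then show ?thesis
    by (simp add: q_def frac_eq_0_iff)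
qed

lemma integral_kernel:
  obtains N where "finite N" "N \<subseteq> int_points" "span B = {x. \<forall>n\<in>N. n \<bullet> x = 0}"
proof -
  obtain N where N: "finite N" "\<And>n. n \<in> N \<Longrightarrow> rat_vec n" "span B = {x. \<forall>n\<in>N. n \<bullet> x = 0}"
    using rational_span_eq_kernel[OF finite_B int_points_rat_vec[OF subsetD[OF B_int]]] by blast
  then have "\<exists>D::nat. D > 0 \<and> real D *\<^sub>R n \<in> int_points" if "n \<in> N" for n
    using that rat_vec_clear_denominators by metis
  then obtain D :: "_ \<Rightarrow> nat" where D: "\<And>n. n \<in> N \<Longrightarrow> D n > 0 \<and> real (D n) *\<^sub>R n \<in> int_points"
    by metis
  show thesis
  proof (rule that[of "(\<lambda>n. real (D n) *\<^sub>R n) ` N"])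
    show "span B = {x. \<forall>n\<in>(\<lambda>n. real (D n) *\<^sub>R n) ` N. n \<bullet> x = 0}"
      using N(3) D by fastforce
  qed (use N D in auto)
qed

text \<open>Links splits within \<open>A\<close> to the splits of the whole space in
  \<open>two_partitionable\<close>: the rescaled functional is integral on the integer directions of
  \<open>A\<close>, hence agrees there with an integer vector \<open>p\<close>. The two hyperplanes
  then carry the values \<open>p0\<close> and \<open>p0 + 1\<close>.\<close>

lemma split_functional:
  assumes "split_within_data A a b1 b2"
  obtains p p0 where "p \<in> int_points" "p \<noteq> 0" "p0 \<in> \<int>"
    "\<And>x. x \<in> A \<Longrightarrow> p \<bullet> x = p0 + (a \<bullet> x - b1) / (b2 - b1)"
proof -
  obtain h1 h2 where h: "h1 \<in> A" "h1 \<in> int_points" "a \<bullet> h1 = b1" "h2 \<in> A" "h2 \<in> int_points" "a \<bullet> h2 = b2"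
    and ne: "b1 \<noteq> b2"
    using assms(1) unfolding split_within_data_def by blast
  obtain N where N: "finite N" "N \<subseteq> int_points" "span B = {x. \<forall>n\<in>N. n \<bullet> x = 0}"
    using integral_kernel by blast
  have "\<exists>p\<in>int_points. \<forall>x. (\<forall>n\<in>N. n \<bullet> x = 0) \<longrightarrow> p \<bullet> x = ((1 / (b2 - b1)) *\<^sub>R a) \<bullet> x"
  proof (rule integral_functional_extends[OF N(1,2)])
    fix z :: "real^'m" assume "z \<in> int_points" "\<forall>n\<in>N. n \<bullet> z = 0"
    then show "((1 / (b2 - b1)) *\<^sub>R a) \<bullet> z \<in> \<int>"
      using split_integral[OF assms, of z] N(3) by simp
  qed
  then obtain p where p: "p \<in> int_points" "\<And>x. x \<in> span B \<Longrightarrow> p \<bullet> x = (a \<bullet> x) / (b2 - b1)"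
    using N(3) by auto
  have *: "p \<bullet> x = p \<bullet> h1 + (a \<bullet> x - b1) / (b2 - b1)" if "x \<in> A" for x
    using p(2)[OF diff_in[OF that h(1)]] h(3) by (simp add: inner_diff_right)
  have "p \<bullet> h2 = p \<bullet> h1 + 1"
    using *[OF h(4)] h(6) ne by simp
  then have "p \<noteq> 0"
    by auto
  with that p(1) * show thesis
    using int_points_inner[OF p(1) h(2)] by blast
qed

section \<open>Consequences of lying between the hyperplanes of a split\<close>

text \<open>All integer points of \<open>K\<close> lie on the two boundary hyperplanes. If those of
  a nonempty face \<open>G\<close> were all on one of them, \<open>G\<close> would lie in the proper
  face that this hyperplane supports, hence in a facet of \<open>K\<close>. Otherwise the split
  itself partitions them.\<close>

lemma strip_two_hyperplane:
  assumes "split_within_data A a b1 b2" "polytope K" "affine hull K = A"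
    and "\<And>x. x \<in> K \<Longrightarrow> b1 \<le> a \<bullet> x \<and> a \<bullet> x \<le> b2"
  shows "two_hyperplane_property K"
  unfolding two_hyperplane_property_def
proof (intro allI impI, elim conjE)
  fix G assume G: "G face_of integer_hull K" "\<not> (\<exists>F. F facet_of K \<and> G \<subseteq> F)"
  have ne: "b1 \<noteq> b2" and nc: "\<exists>x\<in>A. \<exists>y\<in>A. a \<bullet> x \<noteq> a \<bullet> y"
    and no: "\<And>w. w \<in> A \<Longrightarrow> w \<in> int_points \<Longrightarrow> \<not> strictly_between b1 b2 (a \<bullet> w)"
    using assms(1) unfolding split_within_data_def by blast+
  have K: "convex K" "bounded K" "polyhedron K"
    using assms(2) polytope_imp_convex polytope_imp_bounded polytope_imp_polyhedron by blast+
  have KA: "K \<subseteq> A"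
    using assms(3) hull_subset[of K affine] by simp
  have GK: "G \<subseteq> K"
    using face_of_imp_subset[OF G(1)] integer_hull_subset[OF K(1)] by blast
  define S1 S2 where "S1 = G \<inter> int_points \<inter> {x. a \<bullet> x = b1}" and "S2 = G \<inter> int_points \<inter> {x. a \<bullet> x = b2}"
  have "a \<bullet> x = b1 \<or> a \<bullet> x = b2" if "x \<in> G" "x \<in> int_points" for x
  proof -
    have "x \<in> K" "x \<in> A"
      using that GK KA by auto
    then show ?thesis
      using no[of x] assms(4)[of x] that unfolding strictly_between_def by linarith
  qed
  then have S: "S1 \<union> S2 = G \<inter> int_points" "S1 \<inter> S2 = {}"
    using ne by (auto simp: S1_def S2_def)
  have side: "b = b1 \<or> b = b2 \<Longrightarrow> G \<inter> int_points \<noteq> {} \<Longrightarrow> \<not> G \<inter> int_points \<subseteq> {x. a \<bullet> x = b}" for b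
  proof
    assume b: "b = b1 \<or> b = b2" and nonempty: "G \<inter> int_points \<noteq> {}" 
      and sub: "G \<inter> int_points \<subseteq> {x. a \<bullet> x = b}"
    have GH: "G \<subseteq> K \<inter> {x. a \<bullet> x = b}"
    proof -
      have "convex hull (G \<inter> int_points) \<subseteq> {x. a \<bullet> x = b}"
        using sub by (intro hull_minimal convex_hyperplane)
      then show ?thesis
        using face_of_integer_hull[OF K(2) G(1)] GK by auto
    qed
    have face: "(K \<inter> {x. a \<bullet> x = b}) face_of K"
      using b assms(4) K(1)
      by (auto intro: face_of_Int_supporting_hyperplane_le face_of_Int_supporting_hyperplane_ge)
    have proper: "K \<inter> {x. a \<bullet> x = b} \<noteq> K"
    proof
      assume "K \<inter> {x. a \<bullet> x = b} = K"
      then have "A \<subseteq> {x. a \<bullet> x = b}"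
        unfolding assms(3)[symmetric] by (intro hull_minimal affine_hyperplane) auto
      then show False
        using nc by (metis (mono_tags) mem_Collect_eq subsetD)
    qed
    show False
    proof (rule face_of_polyhedron_subset_facet[OF K(3) face _ proper])
      show "K \<inter> {x. a \<bullet> x = b} \<noteq> {}"
        using GH nonempty by blast
      fix F assume "F facet_of K" "K \<inter> {x. a \<bullet> x = b} \<subseteq> F"
      then show False
        using GH G(2) by blast
    qed
  qed
  show "two_partitionable (G \<inter> int_points)"
  proof (cases "G \<inter> int_points = {}")
    case True
    then show ?thesis
      by (simp add: two_partitionable_def)
  next
    case False
    then have ne12: "S1 \<noteq> {}" "S2 \<noteq> {}"
      using side[of b1] side[of b2] S by (auto simp: S1_def S2_def)
    obtain p p0 where p: "p \<in> int_points" "p \<noteq> 0" "p0 \<in> \<int>"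
       "\<And>x. x \<in> A \<Longrightarrow> p \<bullet> x = p0 + (a \<bullet> x - b1) / (b2 - b1)"
      using split_functional[OF assms(1)] by blast
    have "S1 \<subseteq> {x. p \<bullet> x = p0}" "S2 \<subseteq> {x. p \<bullet> x = p0 + 1}"
      using GK KA p(4) ne by (auto simp: S1_def S2_def subset_iff)
    then show ?thesis
      unfolding two_partitionable_def using p S ne12 by blast
  qed
qed

text \<open>An integer point of \<open>K\<close> lies on a boundary hyperplane, so it maximizes
  \<open>a\<close> or \<open>- a\<close> on \<open>K\<close>. In the relative interior this would
  make \<open>a\<close> constant on \<open>A\<close>.\<close>

lemma strip_lattice_free:
  assumes "split_within_data A a b1 b2" "convex K" "affine hull K = A"
    and "\<And>x. x \<in> K \<Longrightarrow> b1 \<le> a \<bullet> x \<and> a \<bullet> x \<le> b2"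
  shows "lattice_free_in_aff K"
proof -
  have nc: "\<exists>x\<in>A. \<exists>y\<in>A. a \<bullet> x \<noteq> a \<bullet> y"
    and no: "\<And>w. w \<in> A \<Longrightarrow> w \<in> int_points \<Longrightarrow> \<not> strictly_between b1 b2 (a \<bullet> w)"
    using assms(1) unfolding split_within_data_def by blast+
  have False if r: "r \<in> rel_interior K" "r \<in> int_points" for r
  proof -
    have rK: "r \<in> K"
      using r(1) rel_interior_subset by blast
    then have "r \<in> A"
      using assms(3) hull_inc[of r K affine] by simp
    then have "a \<bullet> r = b1 \<or> a \<bullet> r = b2"
      using no[of r] r(2) assms(4)[OF rK] unfolding strictly_between_def by linarith
    then show False
    proof
      assume "a \<bullet> r = b1"
      then have "- a \<bullet> x = - a \<bullet> r" if "x \<in> A" for x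
        using that assms by (intro linear_max_at_rel_interior_imp_constant[OF assms(2) r(1)]) auto
      then show False
        using nc by fastforce
    next
      assume "a \<bullet> r = b2"
      then have "a \<bullet> x = a \<bullet> r" if "x \<in> A" for x
        using that assms by (intro linear_max_at_rel_interior_imp_constant[OF assms(2) r(1)]) auto
      then show False
        using nc by fastforce
    qed
  qed
  then show ?thesis
    using assms(2) by (auto simp: lattice_free_in_aff_def)
qed

section \<open>Facet splits and half-open splits\<close>

text \<open>The obstruction to (ii): \<open>K\<close> lies in a split, touching at most the
  hyperplane at \<open>b1\<close> and missing the one at \<open>b2\<close>. The order of
  \<open>b1\<close> and \<open>b2\<close> is left open. Subsets inherit the obstruction, so
  enlarging a polytope never introduces it.\<close>

definition in_half_open_split :: "(real^'m) set \<Rightarrow> bool" where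
  "in_half_open_split K \<longleftrightarrow> (\<exists>a b1 b2. split_within_data A a b1 b2 \<and>
     (\<forall>x\<in>K. a \<bullet> x = b1 \<or> strictly_between b1 b2 (a \<bullet> x)))"

text \<open>The hyperplane of \<open>F\<close> contains integer points, so it can serve as
  \<open>H1\<close> itself; \<open>H2\<close> is the next parallel hyperplane with integer points on
  the side of \<open>K\<close>. This keeps (ii) from being vacuous.\<close>

lemma facet_split_exists:
  assumes "rational_polytope K" "affine hull K = A" "F facet_of K" "affine hull F \<inter> int_points \<noteq> {}"
  shows "\<exists>H1 H2. facet_split A K F H1 H2"
proof -
  obtain a c where ac: "rat_vec a" "\<And>x. x \<in> K \<Longrightarrow> a \<bullet> x \<le> c" "F = K \<inter> {x. a \<bullet> x = c}"
    and ncK: "\<exists>x\<in>K. \<exists>y\<in>K. a \<bullet> x \<noteq> a \<bullet> y"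
    using facet_rational_normal[OF assms(1,3)] by blast
  have conv: "convex K"
    using assms(1) rational_polytope_imp_polytope polytope_imp_convex by blast
  have nc: "\<exists>x\<in>A. \<exists>y\<in>A. a \<bullet> x \<noteq> a \<bullet> y"
    using ncK assms(2) hull_subset[of K affine] by blast
  have "affine hull F = A \<inter> {x. a \<bullet> x = c}"
    using facet_hyperplane(1)[OF conv assms(3), of a c] ac nc assms(2) by auto
  then obtain z where z: "z \<in> A" "z \<in> int_points" "a \<bullet> z = c"
    using assms(4) by auto
  obtain w where w: "w \<in> A" "w \<in> int_points" "a \<bullet> w < c"
    "\<And>y. y \<in> A \<Longrightarrow> y \<in> int_points \<Longrightarrow> a \<bullet> y < c \<Longrightarrow> a \<bullet> y \<le> a \<bullet> w"
    using lattice_value_below[OF ac(1), of c] nc nonconstant_iff by blast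
  have split: "split_within_data A a c (a \<bullet> w)"
    unfolding split_within_data_def strictly_between_def
    using ac(1) nc z w by (fastforce dest: w(4))
  obtain f where f: "f \<in> K" "a \<bullet> f = c"
    using assms(3) ac(3) by (auto simp: facet_of_def)
  obtain x where x: "x \<in> K" "a \<bullet> x < c"
    using ncK ac(2) by (metis order_le_less)
  have "\<exists>y\<in>K. strictly_between c (a \<bullet> w) (a \<bullet> y)"
  proof (cases "a \<bullet> x > a \<bullet> w")
    case True
    then show ?thesis
      using x by (auto simp: strictly_between_def)
  next
    case False
    have "connected K"
      using conv convex_connected by blast
    then obtain y where "y \<in> K" "a \<bullet> y = (c + a \<bullet> w) / 2"
      using connected_ivt_hyperplane[of K x f a "(c + a \<bullet> w) / 2"] x f w(3) False by auto
    then show ?thesis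
      using w(3) by (intro bexI[of _ y]) (auto simp: strictly_between_def)
  qed
  then have "facet_split A K F (A \<inter> {x. a \<bullet> x = c}) (A \<inter> {x. a \<bullet> x = a \<bullet> w})"
    unfolding facet_split_def using split ac(3) by blast
  then show ?thesis
    by blast
qed

text \<open>An integer point in the hyperplane of \<open>F\<close> cannot lie strictly inside the
  split, so \<open>c = b1\<close> and \<open>H1\<close> meets \<open>K\<close> in \<open>F\<close>.
  If \<open>H2\<close> missed \<open>K\<close>, connectedness would keep \<open>K\<close> on the
  near side of \<open>b2\<close> while the facet keeps it on one side of \<open>b1\<close>, which is
  a half-open split.\<close>

lemma facet_split_intersecting:
  assumes "convex K" "affine hull K = A" "F facet_of K" "affine hull F \<inter> int_points \<noteq> {}"
    and "\<not> in_half_open_split K" and "facet_split A K F H1 H2"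
  shows "intersecting_split K H1 H2"
proof -
  obtain a b1 b2 c y where sd: "split_within_data A a b1 b2"
      and H: "H1 = A \<inter> {x. a \<bullet> x = b1}" "H2 = A \<inter> {x. a \<bullet> x = b2}"
      and c: "\<And>x. x \<in> F \<Longrightarrow> a \<bullet> x = c" "c = b1 \<or> strictly_between b1 b2 c"
      and y: "y \<in> K" "strictly_between c b2 (a \<bullet> y)"
    using assms(6) unfolding facet_split_def by blast
  have nc: "\<exists>x\<in>A. \<exists>y\<in>A. a \<bullet> x \<noteq> a \<bullet> y"
    and no: "\<And>w. w \<in> A \<Longrightarrow> w \<in> int_points \<Longrightarrow> \<not> strictly_between b1 b2 (a \<bullet> w)"
    using sd unfolding split_within_data_def by blast+
  note fh = facet_hyperplane[OF assms(1,3) c(1), unfolded assms(2), OF _ nc]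
  obtain z where "z \<in> A" "z \<in> int_points" "a \<bullet> z = c"
    using assms(4) fh(1) by auto
  then have cb: "c = b1"
    using no c(2) by blast
  have KA: "K \<subseteq> A"
    using assms(2) hull_subset[of K affine] by simp
  obtain f where f: "f \<in> F"
    using assms(3) by (auto simp: facet_of_def)
  have fK: "f \<in> K" "a \<bullet> f = b1"
    using f assms(3) facet_of_imp_subset c(1) cb by blast+
  have "H2 \<inter> K \<noteq> {}"
  proof
    assume "H2 \<inter> K = {}"
    then have nb2: "a \<bullet> x \<noteq> b2" if "x \<in> K" for x
      using that KA H by auto
    have conn: "connected K"
      using assms(1) convex_connected by blast
    have "a \<bullet> x = b1 \<or> strictly_between b1 b2 (a \<bullet> x)" if x: "x \<in> K" for x
    proof (cases "b1 < b2")
      case True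
      then have "a \<bullet> y > c"
        using y(2) cb by (auto simp: strictly_between_def)
      then have "a \<bullet> x \<ge> b1"
        using fh(3) y(1) x cb by force
      moreover have "\<not> a \<bullet> x > b2"
        using connected_ivt_hyperplane[OF conn fK(1) x, of a b2] fK(2) True nb2 by force
      ultimately show ?thesis
        using nb2[OF x] by (auto simp: strictly_between_def)
    next
      case False
      then have "a \<bullet> y < c"
        using y(2) cb by (auto simp: strictly_between_def)
      then have "a \<bullet> x \<le> b1"
        using fh(3) y(1) x cb by force
      moreover have "\<not> a \<bullet> x < b2"
        using connected_ivt_hyperplane[OF conn x fK(1), of a b2] fK(2) False nb2 by force
      ultimately show ?thesis
        using nb2[OF x] by (auto simp: strictly_between_def)
    qed
    then show False
      using assms(5) sd unfolding in_half_open_split_def by blast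
  qed
  moreover have "H1 \<inter> K \<noteq> {}"
    using fK KA H by blast
  ultimately show ?thesis
    by (simp add: intersecting_split_def)
qed

end

text \<open>Equal integer points give equal integer hulls, so the two properties can differ only in
  which faces are exempt. The empty face is 2-partitionable anyway.\<close>

lemma two_hyperplane_property_cong:
  assumes "K \<inter> int_points = K' \<inter> int_points"
    and "\<And>G. G face_of integer_hull K \<Longrightarrow> G \<noteq> {} \<Longrightarrow>
      (\<exists>F. F facet_of K \<and> G \<subseteq> F) \<longleftrightarrow> (\<exists>F. F facet_of K' \<and> G \<subseteq> F)"
  shows "two_hyperplane_property K \<longleftrightarrow> two_hyperplane_property K'"
proof -
  have hull: "integer_hull K' = integer_hull K"
    using assms(1) by (simp add: integer_hull_def)
  have empty: "two_partitionable ({} \<inter> int_points)"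
    by (simp add: two_partitionable_def)
  show ?thesis
    unfolding two_hyperplane_property_def hull using assms(2) empty by metis
qed

context lattice_flat
begin

lemma in_half_open_split_mono:
  assumes "K \<subseteq> K'" "in_half_open_split K'"
  shows "in_half_open_split K"
proof -
  obtain a b1 b2 where "split_within_data A a b1 b2"
    "\<And>x. x \<in> K' \<Longrightarrow> a \<bullet> x = b1 \<or> strictly_between b1 b2 (a \<bullet> x)"
    using assms(2) unfolding in_half_open_split_def by blast
  then show ?thesis
    using assms(1) unfolding in_half_open_split_def by (intro exI[of _ a] exI[of _ b1] exI[of _ b2]) auto
qed

subsection \<open>Polytopes contained in a split\<close>

text \<open>Integer points of both hyperplanes that affinely span \<open>A\<close> are added to
  \<open>L\<close>. A half-open split can contain integer points only on its closed side, so its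
  functional would be constant on these points and hence on \<open>A\<close>.\<close>

lemma strip_enlarge:
  assumes sd: "split_within_data A a b1 b2" and L: "rational_polytope L" "affine hull L = A"
    and strip: "\<And>x. x \<in> L \<Longrightarrow> b1 \<le> a \<bullet> x \<and> a \<bullet> x \<le> b2" and "b1 < b2"
  obtains K h1 h2 where "rational_polytope K" "L \<subseteq> K" "affine hull K = A"
    "\<And>x. x \<in> K \<Longrightarrow> b1 \<le> a \<bullet> x \<and> a \<bullet> x \<le> b2" "\<not> in_half_open_split K"
    "h1 \<in> K" "h1 \<in> int_points" "a \<bullet> h1 = b1" "h2 \<in> K" "h2 \<in> int_points" "a \<bullet> h2 = b2"
proof -
  obtain S where S: "finite S" "\<And>x. x \<in> S \<Longrightarrow> rat_vec x" "L = convex hull S"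
    using L(1) by (auto simp: rational_polytope_def)
  obtain h1 h2 where h: "h1 \<in> A" "h1 \<in> int_points" "a \<bullet> h1 = b1" "h2 \<in> A" "h2 \<in> int_points" "a \<bullet> h2 = b2"
    using sd unfolding split_within_data_def by blast
  \<comment> \<open>\<open>g b\<close> is the integer point \<open>h1 + b\<close> pushed back onto
    the first hyperplane along \<open>h2 - h1\<close>; the multiple \<open>k b\<close> is an integer
    by \<open>split_integral\<close>.\<close>
  define k where "k b = (a \<bullet> b) / (b2 - b1)" for b
  define g where "g b = h1 + (b - k b *\<^sub>R (h2 - h1))" for b
  have g: "g b \<in> A" "g b \<in> int_points" "a \<bullet> g b = b1" if b: "b \<in> B" for b
  proof -
    have "b \<in> int_points"
      using b B_int by blast
    then have "k b \<in> \<int>"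
      unfolding k_def using sd b span_base by (intro split_integral) auto
    then show "g b \<in> int_points"
      unfolding g_def using h \<open>b \<in> int_points\<close> by (intro int_points_add int_points_diff int_points_scaleR)
    show "g b \<in> A"
      unfolding g_def
      by (rule add_in[OF h(1) span_diff[OF span_base[OF b] span_scale[OF diff_in[OF h(4,1)]]]])
    show "a \<bullet> g b = b1"
      using h \<open>b1 < b2\<close> by (simp add: g_def k_def inner_add_right inner_diff_right)
  qed
  define X where "X = insert h1 (insert h2 (g ` B))"
  have X: "X \<subseteq> A" "X \<subseteq> int_points" "\<And>x. x \<in> X \<Longrightarrow> b1 \<le> a \<bullet> x \<and> a \<bullet> x \<le> b2" "finite X"
    using h g \<open>b1 < b2\<close> finite_B by (auto simp: X_def)
  define K where "K = convex hull (S \<union> X)"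
  have XK: "X \<subseteq> K" and LK: "L \<subseteq> K"
    using hull_subset[of "S \<union> X" convex] hull_mono[of S "S \<union> X" convex] by (auto simp: K_def S(3))
  have SA: "S \<subseteq> A" and SL: "S \<subseteq> L"
    using L(2) S(3) hull_subset[of S convex] hull_subset[of L affine] by auto
  have "rational_polytope K"
    unfolding rational_polytope_def K_def using S X(2,4)
    by (intro exI[of _ "S \<union> X"]) (auto intro: int_points_rat_vec)
  moreover have "affine hull K = A"
  proof
    have "K \<subseteq> A"
      unfolding K_def using SA X(1) affine_A by (intro hull_minimal) (auto simp: affine_imp_convex)
    then show "affine hull K \<subseteq> A"
      using affine_A by (rule hull_minimal)
    show "A \<subseteq> affine hull K"
      unfolding L(2)[symmetric] using LK by (rule hull_mono)
  qed
  moreover have "b1 \<le> a \<bullet> x \<and> a \<bullet> x \<le> b2" if "x \<in> K" for x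
  proof -
    have "convex ({x. a \<bullet> x \<ge> b1} \<inter> {x. a \<bullet> x \<le> b2})"
      by (intro convex_Int convex_halfspace_le convex_halfspace_ge)
    moreover have "S \<union> X \<subseteq> {x. a \<bullet> x \<ge> b1} \<inter> {x. a \<bullet> x \<le> b2}"
      using X(3) strip SL by auto
    ultimately have "K \<subseteq> {x. a \<bullet> x \<ge> b1} \<inter> {x. a \<bullet> x \<le> b2}"
      unfolding K_def by (metis hull_minimal)
    then show ?thesis
      using that by auto
  qed
  moreover have "\<not> in_half_open_split K"
  proof
    assume "in_half_open_split K"
    then obtain a' c1 c2 where sd': "split_within_data A a' c1 c2"
      and half: "\<And>x. x \<in> K \<Longrightarrow> a' \<bullet> x = c1 \<or> strictly_between c1 c2 (a' \<bullet> x)"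
      unfolding in_half_open_split_def by blast
    \<comment> \<open>The points of \<open>X\<close> are integer points of \<open>A\<close>, so none
      of them lies strictly between \<open>c1\<close> and \<open>c2\<close>.\<close>
    have c1: "a' \<bullet> x = c1" if "x \<in> X" for x
      using half[of x] sd' X that XK unfolding split_within_data_def by blast
    have "a' \<bullet> b = 0" if "b \<in> B" for b
      using c1[of "g b"] c1[of h1] c1[of h2] that by (simp add: X_def g_def inner_add_right inner_diff_right)
    then show False
      using sd' nonconstant_iff unfolding split_within_data_def by blast
  qed
  ultimately show thesis
    using that[of K h1 h2] LK h XK by (auto simp: X_def)
qed

text \<open>All directions of \<open>A\<close> are multiples of \<open>b0\<close>, and a multiple of
  \<open>b0\<close> orthogonal to \<open>b0\<close> is 0.\<close>

lemma line_inner_inj: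
  assumes "B \<subseteq> span {b0}" "x \<in> A" "y \<in> A" "b0 \<bullet> x = b0 \<bullet> y"
  shows "x = y"
proof -
  have "span B \<subseteq> span {b0}"
    using assms(1) by (metis span_mono span_span)
  then obtain t where t: "x - y = t *\<^sub>R b0"
    using diff_in[OF assms(2,3)] by (auto simp: span_singleton)
  then have "b0 \<bullet> (t *\<^sub>R b0) = 0"
    using assms(4) by (simp add: inner_diff_right flip: t)
  then have "x - y = 0"
    unfolding t by auto
  then show ?thesis
    by simp
qed

text \<open>The split consists of the lattice values next to that of a relative interior point
  \<open>r\<close>, below and above. The value at \<open>r\<close> is itself not a lattice value,
  since on a line the integer point attaining it would be \<open>r\<close>.\<close>

lemma line_in_strip:
  assumes "b0 \<in> B" "b0 \<noteq> 0" "B \<subseteq> span {b0}"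
    and L: "lattice_free_in_aff L" "affine hull L = A"
  obtains b1 b2 where "split_within_data A b0 b1 b2" "b1 < b2"
    "\<And>x. x \<in> L \<Longrightarrow> b1 \<le> b0 \<bullet> x \<and> b0 \<bullet> x \<le> b2"
proof -
  have conv: "convex L"
    using L(1) by (simp add: lattice_free_in_aff_def)
  have "L \<noteq> {}"
    using L(2) z0_in by auto
  then obtain r where r: "r \<in> rel_interior L"
    using conv rel_interior_eq_empty by blast
  have LA: "L \<subseteq> A"
    using L(2) hull_subset[of L affine] by simp
  have rA: "r \<in> A"
    using r rel_interior_subset LA by blast
  have rat: "rat_vec b0"
    using assms(1) B_int int_points_rat_vec by blast
  have nc: "\<exists>b\<in>B. b0 \<bullet> b \<noteq> 0"
    using assms(1,2) by (intro bexI[of _ b0]) auto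
  obtain z1 where z1: "z1 \<in> A" "z1 \<in> int_points" "b0 \<bullet> z1 < b0 \<bullet> r"
    "\<And>w. w \<in> A \<Longrightarrow> w \<in> int_points \<Longrightarrow> b0 \<bullet> w < b0 \<bullet> r \<Longrightarrow> b0 \<bullet> w \<le> b0 \<bullet> z1"
    using lattice_value_below[OF rat nc] by blast
  obtain z2 where z2: "z2 \<in> A" "z2 \<in> int_points" "b0 \<bullet> z2 > b0 \<bullet> r"
    "\<And>w. w \<in> A \<Longrightarrow> w \<in> int_points \<Longrightarrow> b0 \<bullet> w > b0 \<bullet> r \<Longrightarrow> b0 \<bullet> w \<ge> b0 \<bullet> z2"
    using lattice_value_above[OF rat nc] by blast
  have "b0 \<bullet> w \<noteq> b0 \<bullet> r" if "w \<in> A" "w \<in> int_points" for w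
    using that line_inner_inj[OF assms(3) that(1) rA] r L(1) by (auto simp: lattice_free_in_aff_def)
  then have "\<not> strictly_between (b0 \<bullet> z1) (b0 \<bullet> z2) (b0 \<bullet> w)" if "w \<in> A" "w \<in> int_points" for w
    using z1(3) z2(3) z1(4)[OF that] z2(4)[OF that] that unfolding strictly_between_def
    by (metis linorder_not_less not_less_iff_gr_or_eq order_less_trans)
  then have sd: "split_within_data A b0 (b0 \<bullet> z1) (b0 \<bullet> z2)"
    unfolding split_within_data_def nonconstant_iff using rat nc z1 z2 by fastforce
  \<comment> \<open>A point of \<open>A\<close> with value strictly between those of
    \<open>r\<close> and \<open>y\<close> lies on the open segment joining them, hence in the
    relative interior of \<open>L\<close>. So \<open>L\<close> cannot extend past \<open>z1\<close>
    or \<open>z2\<close>.\<close>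
  have no: "z \<notin> int_points" if zy: "z \<in> A" "y \<in> L" "strictly_between (b0 \<bullet> r) (b0 \<bullet> y) (b0 \<bullet> z)" for z y
  proof -
    have "connected (closed_segment r y)"
      by simp
    then obtain w where w: "w \<in> closed_segment r y" "b0 \<bullet> w = b0 \<bullet> z"
      using zy(3) connected_ivt_hyperplane[of "closed_segment r y" r y b0 "b0 \<bullet> z"]
        connected_ivt_hyperplane[of "closed_segment r y" y r b0 "b0 \<bullet> z"]
      by (auto simp: strictly_between_def)
    then have "w \<in> open_segment r y"
      using w zy(3) by (auto simp: open_segment_def strictly_between_def)
    then have "w \<in> rel_interior L"
      using rel_interior_closure_convex_segment[OF conv r, of y] zy(2) closure_subset[of L] by blast
    moreover from this have "w \<in> A"
      using rel_interior_subset LA by blast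
    ultimately show ?thesis
      using line_inner_inj[OF assms(3) _ zy(1) w(2)] L(1) by (auto simp: lattice_free_in_aff_def)
  qed
  have "b0 \<bullet> z1 \<le> b0 \<bullet> x \<and> b0 \<bullet> x \<le> b0 \<bullet> z2" if "x \<in> L" for x
    using no[OF z1(1) that] no[OF z2(1) that] z1(2,3) z2(2,3) by (force simp: strictly_between_def)
  then show thesis
    using that sd z1(3) z2(3) by (meson order_less_trans)
qed

subsection \<open>Polytopes of higher dimension\<close>

text \<open>This is where dimension at least two enters: either \<open>b0\<close> is orthogonal to
  \<open>c\<close>, or a combination of \<open>b0\<close> and an independent \<open>t\<close> is,
  and its denominators can be cleared.\<close>

lemma orthogonal_lattice_vector:
  assumes "b0 \<in> B" "b0 \<noteq> 0" "\<not> B \<subseteq> span {b0}" "rat_vec c"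
  obtains v where "v \<in> span B" "v \<in> int_points" "v \<noteq> 0" "c \<bullet> v = 0"
proof (cases "c \<bullet> b0 = 0")
  case True
  then show thesis
    using that[of b0] assms B_int span_base by blast
next
  case False
  obtain t where t: "t \<in> B" "t \<notin> span {b0}"
    using assms(3) by blast
  define u where "u = (c \<bullet> t) *\<^sub>R b0 - (c \<bullet> b0) *\<^sub>R t"
  have rat: "rat_vec t" "rat_vec b0"
    using t(1) assms(1) B_int int_points_rat_vec by blast+
  then have "rat_vec u"
    unfolding u_def using assms(4) by (intro rat_vec_diff rat_vec_scaleR rat_vec_inner)
  then obtain D :: nat where D: "D > 0" "real D *\<^sub>R u \<in> int_points"
    using rat_vec_clear_denominators by blast
  have "u \<noteq> 0"
  proof
    assume "u = 0"
    then have "(1 / (c \<bullet> b0)) *\<^sub>R ((c \<bullet> b0) *\<^sub>R t) = (1 / (c \<bullet> b0)) *\<^sub>R ((c \<bullet> t) *\<^sub>R b0)"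
      by (simp add: u_def)
    then have "t = ((c \<bullet> t) / (c \<bullet> b0)) *\<^sub>R b0"
      using False by simp
    moreover have "((c \<bullet> t) / (c \<bullet> b0)) *\<^sub>R b0 \<in> span {b0}"
      by (intro span_scale span_base) simp
    ultimately show False
      using t(2) by simp
  qed
  moreover have "u \<in> span B"
    unfolding u_def using t(1) assms(1) by (intro span_diff span_scale span_base)
  moreover have "c \<bullet> u = 0"
    by (simp add: u_def inner_diff_right)
  ultimately show thesis
    using that[of "real D *\<^sub>R u"] D by (simp add: span_scale)
qed

text \<open>A rational separating normal \<open>c\<close> is tilted to \<open>t c + v\<close> with \<open>v\<close> an integer vector
  orthogonal to \<open>c\<close>. For large \<open>t\<close> the width of the gap exceeds \<open>v \<bullet> v\<close>, so the
  hyperplane through \<open>e - v\<close> still separates.\<close>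

lemma separation_through_lattice_point:
  assumes "b0 \<in> B" "b0 \<noteq> 0" "\<not> B \<subseteq> span {b0}"
    and K: "rational_polytope K" and e: "e \<in> A" "e \<in> int_points" "e \<notin> K"
  obtains c z where "rat_vec c" "z \<in> A" "z \<in> int_points" "\<And>x. x \<in> K \<Longrightarrow> c \<bullet> x < c \<bullet> z" "c \<bullet> z < c \<bullet> e"
proof -
  obtain S where S: "finite S" "K = convex hull S"
    using K by (auto simp: rational_polytope_def)
  have "convex K" "closed K"
    using S by (simp_all add: finite_imp_compact compact_convex_hull compact_imp_closed)
  then obtain c0 d0 where c0: "c0 \<bullet> e < d0" "\<And>x. x \<in> K \<Longrightarrow> c0 \<bullet> x > d0"
    using separating_hyperplane_closed_point[of K e] e(3) by blast
  have SK: "S \<subseteq> K"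
    using S(2) hull_subset[of S convex] by simp
  \<comment> \<open>The normals placing \<open>e\<close> strictly above all generators form an open
    set. It contains \<open>- c0\<close>, hence also a rational vector.\<close>
  define U where "U = (\<Inter>s\<in>S. {c. c \<bullet> (e - s) > 0})"
  have "open U"
    unfolding U_def using S(1)
    by (intro open_INT ballI) (auto intro!: open_Collect_less continuous_intros)
  moreover have "- c0 \<in> U"
    using c0 SK by (force simp: U_def inner_diff_right)
  ultimately obtain c where c: "c \<in> U" "rat_vec c"
    using rat_vec_dense by blast
  obtain v where v: "v \<in> span B" "v \<in> int_points" "v \<noteq> 0" "c \<bullet> v = 0"
    using orthogonal_lattice_vector[OF assms(1-3) c(2)] by blast
  have "eventually (\<lambda>n. \<forall>s\<in>S. real n * (c \<bullet> (e - s)) > v \<bullet> v - v \<bullet> (e - s)) sequentially"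
    unfolding eventually_ball_finite_distrib[OF S(1)]
  proof
    fix s assume "s \<in> S"
    then have pos: "c \<bullet> (e - s) > 0"
      using c(1) by (auto simp: U_def)
    obtain n0 :: nat where "real n0 > (v \<bullet> v - v \<bullet> (e - s)) / (c \<bullet> (e - s))"
      using reals_Archimedean2 by blast
    then have "real n * (c \<bullet> (e - s)) > v \<bullet> v - v \<bullet> (e - s)" if "n \<ge> n0" for n
      using that pos by (smt (verit) of_nat_mono pos_divide_less_eq)
    then show "eventually (\<lambda>n. real n * (c \<bullet> (e - s)) > v \<bullet> v - v \<bullet> (e - s)) sequentially"
      by (auto simp: eventually_sequentially)
  qed
  then obtain n where n: "\<And>s. s \<in> S \<Longrightarrow> real n * (c \<bullet> (e - s)) > v \<bullet> v - v \<bullet> (e - s)"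
    by (auto simp: eventually_sequentially)
  define c' where "c' = real n *\<^sub>R c + v"
  have c'v: "c' \<bullet> v = v \<bullet> v"
    using v(4) by (simp add: c'_def inner_add_left)
  have "S \<subseteq> {x. c' \<bullet> x < c' \<bullet> (e - v)}"
  proof
    fix s assume "s \<in> S"
    then have "c' \<bullet> (e - s) > v \<bullet> v"
      using n[of s] by (simp add: c'_def inner_add_left)
    then show "s \<in> {x. c' \<bullet> x < c' \<bullet> (e - v)}"
      using c'v by (simp add: inner_diff_right)
  qed
  then have "K \<subseteq> {x. c' \<bullet> x < c' \<bullet> (e - v)}"
    unfolding S(2) by (simp add: hull_minimal convex_halfspace_lt)
  moreover have "rat_vec c'"
    unfolding c'_def using c(2) int_points_rat_vec[OF v(2)] by (intro rat_vec_add rat_vec_scaleR) auto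
  moreover have "e - v \<in> A"
    using add_in[OF e(1) span_neg[OF v(1)]] by simp
  moreover have "c' \<bullet> (e - v) < c' \<bullet> e"
    using c'v v(3) by (simp add: inner_diff_right)
  ultimately show thesis
    using that[of c' "e - v"] e(2) v(2) by (auto intro: int_points_diff)
qed

section \<open>Polytopes cut out of the flat by inequalities\<close>

definition cut_out :: "((real^'m) \<times> real) set \<Rightarrow> (real^'m) set" where
  "cut_out C = {x \<in> A. \<forall>(c, d)\<in>C. c \<bullet> x \<le> d}"

lemma rational_polytope_cut_out:
  assumes "finite C" "\<And>c d. (c, d) \<in> C \<Longrightarrow> rat_vec c \<and> d \<in> \<rat>" "bounded (cut_out C)"
  shows "rational_polytope (cut_out C)"
proof -
  obtain N where N: "finite N" "N \<subseteq> int_points" "span B = {x. \<forall>n\<in>N. n \<bullet> x = 0}"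
    using integral_kernel by blast
  define E where "E = C \<union> (\<lambda>n. (n, n \<bullet> z0)) ` N \<union> (\<lambda>n. (- n, - (n \<bullet> z0))) ` N"
  have "x \<in> A \<longleftrightarrow> (\<forall>n\<in>N. n \<bullet> x \<le> n \<bullet> z0 \<and> - n \<bullet> x \<le> - (n \<bullet> z0))" for x
    by (auto simp: A_eq N(3) inner_diff_right intro: antisym)
  then have "cut_out C = {x. \<forall>(c, d)\<in>E. c \<bullet> x \<le> d}"
    unfolding cut_out_def E_def by (auto simp: ball_Un)
  moreover have "rat_vec c \<and> d \<in> \<rat>" if "(c, d) \<in> E" for c d
    using that assms(2) int_points_rat_vec[OF subsetD[OF N(2)]] int_points_rat_vec[OF z0_int]
    by (auto simp: E_def rat_vec_inner intro: rat_vec_minus)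
  ultimately show ?thesis
    using assms(1,3) N(1) by (intro rational_polytope_if_bounded_rational_system[of E]) (auto simp: E_def)
qed

text \<open>If no constraint were tight at a relative interior point \<open>r\<close> of
  \<open>F\<close>, then \<open>r\<close> would be in the relative interior of the whole set, which
  a proper face avoids. A constraint tight at \<open>r\<close> is maximal there on \<open>F\<close>,
  hence constant on \<open>F\<close>.\<close>

lemma facet_of_cut_out:
  assumes "finite C" "affine hull (cut_out C) = A" "F facet_of cut_out C"
  obtains c d where "(c, d) \<in> C" "\<And>x. x \<in> F \<Longrightarrow> c \<bullet> x = d"
proof -
  have F: "F face_of cut_out C" "F \<noteq> {}" "F \<noteq> cut_out C"
    using assms(3) by (auto simp: facet_of_def)
  have convF: "convex F"
    using F(1) face_of_imp_convex by blast
  obtain r where r: "r \<in> rel_interior F"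
    using convF F(2) rel_interior_eq_empty by blast
  have FP: "F \<subseteq> cut_out C"
    using F(1) face_of_imp_subset by blast
  have rF: "r \<in> F"
    using r rel_interior_subset by blast
  have rni: "r \<notin> rel_interior (cut_out C)"
    using face_of_disjoint_rel_interior[OF F(1,3)] rF by blast
  have "\<exists>(c, d)\<in>C. c \<bullet> r = d"
  proof (rule ccontr)
    assume "\<not> ?thesis"
    then have less: "\<forall>(c, d)\<in>C. c \<bullet> r < d"
      using FP rF unfolding cut_out_def by fastforce
    define U where "U = (\<Inter>p\<in>C. {x. fst p \<bullet> x < snd p})"
    have "open U"
      unfolding U_def using assms(1) by (intro open_INT ballI open_halfspace_lt) auto
    moreover have "r \<in> U"
      using less by (auto simp: U_def)
    moreover have "U \<inter> A \<subseteq> cut_out C"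
      by (force simp: U_def cut_out_def)
    ultimately have "r \<in> rel_interior (cut_out C)"
      using FP rF assms(2) by (auto simp: mem_rel_interior)
    then show False
      using rni by blast
  qed
  then obtain c d where cd: "(c, d) \<in> C" "c \<bullet> r = d"
    by blast
  have le: "c \<bullet> x \<le> c \<bullet> r" if "x \<in> F" for x
    using that FP cd by (auto simp: cut_out_def)
  have "c \<bullet> x = d" if "x \<in> F" for x
    using linear_max_at_rel_interior_imp_constant[OF convF r le] that cd(2) by (simp add: hull_inc)
  then show thesis
    using that cd(1) by blast
qed

text \<open>The integer point on the hyperplane secures (i) for a facet coming from this cut;
  strictness on \<open>K\<close> ensures that no nonempty face of the integer hull of
  \<open>K\<close> lies in such a facet.\<close>

definition strict_cut :: "(real^'m) set \<Rightarrow> (real^'m) \<times> real \<Rightarrow> bool" where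
  "strict_cut K p \<longleftrightarrow> rat_vec (fst p) \<and> (\<exists>z\<in>A \<inter> int_points. fst p \<bullet> z = snd p) \<and>
     (\<forall>x\<in>K. fst p \<bullet> x < snd p)"

text \<open>If \<open>a\<close> varies on \<open>A\<close>, one hyperplane through a lattice value
  above all values on \<open>K\<close> suffices. If \<open>a\<close> is constant on
  \<open>A\<close>, the empty set of cuts already bounds it.\<close>

lemma strict_cuts_bounding_functional:
  assumes "bounded K" "rat_vec a"
  shows "\<exists>J M. finite J \<and> (\<forall>p\<in>J. strict_cut K p) \<and> (\<forall>x\<in>cut_out J. a \<bullet> x \<le> M)"
proof (cases "\<exists>b\<in>B. a \<bullet> b \<noteq> 0")
  case True
  have "bounded ((\<bullet>) a ` K)"
    using assms(1) bounded_linear_image bounded_linear_inner_right by blast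
  then obtain r where r: "\<And>x. x \<in> K \<Longrightarrow> a \<bullet> x \<le> r"
    unfolding bounded_iff by (metis abs_le_D1 imageI real_norm_def)
  obtain z where z: "z \<in> A" "z \<in> int_points" "a \<bullet> z > r"
    using lattice_value_above[OF assms(2) True] by blast
  then have "strict_cut K (a, a \<bullet> z)"
    using assms(2) r by (force simp: strict_cut_def)
  then show ?thesis
    by (intro exI[of _ "{(a, a \<bullet> z)}"] exI[of _ "a \<bullet> z"]) (auto simp: cut_out_def)
next
  case False
  then have "a \<bullet> x = a \<bullet> z0" if "x \<in> A" for x
    using that z0_in nonconstant_iff by blast
  then show ?thesis
    by (intro exI[of _ "{}"] exI[of _ "a \<bullet> z0"]) (auto simp: cut_out_def)
qed

lemma strict_cuts_bounded:
  assumes "bounded K"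
  obtains J where "finite J" "\<And>p. p \<in> J \<Longrightarrow> strict_cut K p" "bounded (cut_out J)"
proof -
  have "\<exists>J M. finite J \<and> (\<forall>p\<in>J. strict_cut K p) \<and> (\<forall>x\<in>cut_out J. \<bar>x $ i\<bar> \<le> M)" for i
  proof -
    obtain J1 M1 where 1: "finite J1" "\<forall>p\<in>J1. strict_cut K p" "\<forall>x\<in>cut_out J1. axis i 1 \<bullet> x \<le> M1"
      using strict_cuts_bounding_functional[OF assms, of "axis i 1"] by auto
    obtain J2 M2 where 2: "finite J2" "\<forall>p\<in>J2. strict_cut K p" "\<forall>x\<in>cut_out J2. - axis i 1 \<bullet> x \<le> M2"
      using strict_cuts_bounding_functional[OF assms, of "- axis i 1"] rat_vec_minus[OF rat_vec_axis] by blast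
    have "\<bar>x $ i\<bar> \<le> max M1 M2" if "x \<in> cut_out (J1 \<union> J2)" for x
    proof -
      have "x \<in> cut_out J1" "x \<in> cut_out J2"
        using that by (auto simp: cut_out_def)
      then show ?thesis
        using 1(3) 2(3) by (fastforce simp: inner_axis')
    qed
    then show ?thesis
      using 1 2 by (intro exI[of _ "J1 \<union> J2"] exI[of _ "max M1 M2"]) auto
  qed
  then obtain J M where J: "\<And>i. finite (J i)" "\<And>i p. p \<in> J i \<Longrightarrow> strict_cut K p"
      "\<And>i x. x \<in> cut_out (J i) \<Longrightarrow> \<bar>x $ i\<bar> \<le> M i"
    by metis
  have "norm x \<le> sum M UNIV" if "x \<in> cut_out (\<Union>i. J i)" for x
  proof -
    have "x \<in> cut_out (J i)" for i
      using that by (auto simp: cut_out_def)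
    then have "(\<Sum>i\<in>UNIV. \<bar>x $ i\<bar>) \<le> sum M UNIV"
      using J(3) by (intro sum_mono) auto
    then show ?thesis
      using norm_le_l1_cart order_trans by blast
  qed
  then have "bounded (cut_out (\<Union>i. J i))"
    by (auto simp: bounded_iff)
  then show thesis
    using J by (intro that[of "\<Union>i. J i"]) auto
qed

text \<open>The facets of \<open>K\<close> that contain integer points are kept and all others are replaced by
  strict cuts, which add no integer points to \<open>K\<close>.\<close>

lemma relax_to_lattice_facets:
  assumes "b0 \<in> B" "b0 \<noteq> 0" "\<not> B \<subseteq> span {b0}"
    and K: "rational_polytope K" "affine hull K = A" "lattice_free_in_aff K"
  obtains L' where "rational_polytope L'" "K \<subseteq> L'" "L' \<subseteq> A" "lattice_free_in_aff L'"
    "two_hyperplane_property K \<longleftrightarrow> two_hyperplane_property L'"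
    "\<And>F. F facet_of L' \<Longrightarrow> affine hull F \<inter> int_points \<noteq> {}"
proof -
  have poly: "polytope K" and conv: "convex K" and bnd: "bounded K"
    using K(1) rational_polytope_imp_polytope polytope_imp_convex polytope_imp_bounded by blast+
  have KA: "K \<subseteq> A"
    using K(2) hull_subset[of K affine] by simp
  have "K \<noteq> {}"
    using K(2) z0_in by auto
  define \<F> where "\<F> = {F. F facet_of K \<and> F \<inter> int_points \<noteq> {}}"
  have "finite \<F>"
    unfolding \<F>_def using finite_polytope_facets[OF poly] by (rule rev_finite_subset) auto
  have "\<exists>p. rat_vec (fst p) \<and> (\<forall>x\<in>K. fst p \<bullet> x \<le> snd p) \<and> F = K \<inter> {x. fst p \<bullet> x = snd p} \<and>
      (\<exists>x\<in>K. \<exists>y\<in>K. fst p \<bullet> x \<noteq> fst p \<bullet> y)" if "F \<in> \<F>" for F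
    using that K(1) by (auto simp: \<F>_def elim!: facet_rational_normal)
  then obtain f where f: "\<And>F. F \<in> \<F> \<Longrightarrow> rat_vec (fst (f F))" "\<And>F x. F \<in> \<F> \<Longrightarrow> x \<in> K \<Longrightarrow> fst (f F) \<bullet> x \<le> snd (f F)"
    "\<And>F. F \<in> \<F> \<Longrightarrow> F = K \<inter> {x. fst (f F) \<bullet> x = snd (f F)}"
    "\<And>F. F \<in> \<F> \<Longrightarrow> \<exists>x\<in>K. \<exists>y\<in>K. fst (f F) \<bullet> x \<noteq> fst (f F) \<bullet> y"
    by metis
  obtain J1 where J1: "finite J1" "\<And>p. p \<in> J1 \<Longrightarrow> strict_cut K p" "bounded (cut_out J1)"
    using strict_cuts_bounded[OF bnd] by blast
  \<comment> \<open>Within the bounded region of \<open>J1\<close> only finitely many integer points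
    lie outside \<open>K\<close>; each is removed by a strict cut of its own.\<close>
  define E where "E = cut_out J1 \<inter> int_points - K"
  have "finite E"
    unfolding E_def using finite_bounded_int_points[OF J1(3)] by simp
  have "\<exists>p. strict_cut K p \<and> snd p < fst p \<bullet> e" if e: "e \<in> E" for e
  proof -
    have "e \<in> A" "e \<in> int_points" "e \<notin> K"
      using e by (auto simp: E_def cut_out_def)
    then obtain c z where "rat_vec c" "z \<in> A" "z \<in> int_points" "\<And>x. x \<in> K \<Longrightarrow> c \<bullet> x < c \<bullet> z" "c \<bullet> z < c \<bullet> e"
      using separation_through_lattice_point[OF assms(1-3) K(1)] by blast
    then show ?thesis
      by (intro exI[of _ "(c, c \<bullet> z)"]) (auto simp: strict_cut_def)
  qed
  then obtain g where g: "\<And>e. e \<in> E \<Longrightarrow> strict_cut K (g e)" "\<And>e. e \<in> E \<Longrightarrow> snd (g e) < fst (g e) \<bullet> e"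
    by metis
  define J where "J = J1 \<union> g ` E"
  have J: "finite J" "\<And>p. p \<in> J \<Longrightarrow> strict_cut K p"
    using J1 g \<open>finite E\<close> by (auto simp: J_def)
  define C where "C = f ` \<F> \<union> J"
  define L' where "L' = cut_out C"
  have finC: "finite C"
    using \<open>finite \<F>\<close> J by (simp add: C_def)
  have C: "rat_vec (fst p) \<and> (\<exists>z\<in>A \<inter> int_points. fst p \<bullet> z = snd p) \<and>
      (\<exists>x\<in>A. \<exists>y\<in>A. fst p \<bullet> x \<noteq> fst p \<bullet> y) \<and> (\<forall>x\<in>K. fst p \<bullet> x \<le> snd p)" if p: "p \<in> C" for p
  proof (cases "p \<in> J")
    case True
    then have sc: "strict_cut K p"
      by (rule J)
    obtain x where "x \<in> K"
      using \<open>K \<noteq> {}\<close> by blast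
    moreover obtain z where "z \<in> A" "fst p \<bullet> z = snd p"
      using sc by (auto simp: strict_cut_def)
    moreover have "fst p \<bullet> x < snd p"
      using sc \<open>x \<in> K\<close> by (auto simp: strict_cut_def)
    ultimately have "\<exists>x\<in>A. \<exists>y\<in>A. fst p \<bullet> x \<noteq> fst p \<bullet> y"
      using KA by (metis order_less_irrefl subsetD)
    then show ?thesis
      using sc by (auto simp: strict_cut_def less_imp_le)
  next
    case False
    then obtain F where F: "F \<in> \<F>" "p = f F"
      using p by (auto simp: C_def)
    then obtain z where "z \<in> F" "z \<in> int_points"
      by (auto simp: \<F>_def)
    then have "z \<in> A \<inter> int_points" "fst p \<bullet> z = snd p"
      using f(3)[OF F(1)] F(2) KA by auto
    then show ?thesis
      using f(1,2,4)[OF F(1)] F(2) KA by blast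
  qed
  have "L' \<subseteq> cut_out J1"
    by (auto simp: L'_def cut_out_def C_def J_def)
  then have bndL': "bounded L'"
    using J1(3) bounded_subset by blast
  have ratC: "rat_vec c \<and> d \<in> \<rat>" if "(c, d) \<in> C" for c d
    using C[OF that] by (auto intro: rat_vec_inner int_points_rat_vec)
  have ratL': "rational_polytope L'"
    unfolding L'_def by (rule rational_polytope_cut_out[OF finC ratC bndL'[unfolded L'_def]])
  then have convL': "convex L'"
    using rational_polytope_imp_polytope polytope_imp_convex by blast
  have KL': "K \<subseteq> L'"
    using C KA by (fastforce simp: L'_def cut_out_def)
  have L'A: "L' \<subseteq> A"
    by (auto simp: L'_def cut_out_def)
  have affL': "affine hull L' = A"
    using hull_mono[OF KL', of affine] hull_minimal[of L' A affine] L'A affine_A K(2) by auto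
  have intL': "L' \<inter> int_points = K \<inter> int_points"
  proof -
    have "x \<in> K" if x: "x \<in> L'" "x \<in> int_points" for x
    proof (rule ccontr)
      assume "x \<notin> K"
      then have xE: "x \<in> E"
        using x \<open>L' \<subseteq> cut_out J1\<close> by (auto simp: E_def)
      then have "g x \<in> C"
        by (simp add: C_def J_def)
      then have "fst (g x) \<bullet> x \<le> snd (g x)"
        using x(1) by (fastforce simp: L'_def cut_out_def)
      then show False
        using g(2)[OF xE] by simp
    qed
    then show ?thesis
      using KL' by auto
  qed
  have L'le: "fst p \<bullet> x \<le> snd p" if "p \<in> C" "x \<in> L'" for p x
    using that by (fastforce simp: L'_def cut_out_def)
  have ncA: "\<not> A \<subseteq> {x. fst p \<bullet> x = d}" if "p \<in> C" for p d
    using C[OF that] by (metis (mono_tags) mem_Collect_eq subsetD)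
  have "lattice_free_in_aff L'"
  proof -
    have False if r: "r \<in> rel_interior L'" "r \<in> int_points" for r
    proof -
      have "r \<in> L'"
        using r(1) rel_interior_subset by blast
      then have "r \<in> K"
        using intL' r(2) by blast
      moreover have "r \<notin> rel_interior K"
        using K(3) r(2) by (auto simp: lattice_free_in_aff_def)
      \<comment> \<open>\<open>r\<close> lies on the relative boundary of \<open>K\<close>, hence in
        a facet of \<open>K\<close>. This facet contains the integer point \<open>r\<close>, so its
        constraint was kept and is tight at \<open>r\<close>.\<close>
      ultimately obtain F where F: "F facet_of K" "r \<in> F"
        using rel_boundary_of_polyhedron[OF polytope_imp_polyhedron[OF poly]] by blast
      then have "F \<in> \<F>"
        using r(2) by (auto simp: \<F>_def)
      then have fF: "f F \<in> C" "fst (f F) \<bullet> r = snd (f F)"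
        using f(3)[of F] F(2) by (auto simp: C_def)
      then have "fst (f F) \<bullet> x = fst (f F) \<bullet> r" if "x \<in> A" for x
        using that affL' L'le[OF fF(1)]
        by (intro linear_max_at_rel_interior_imp_constant[OF convL' r(1)]) auto
      then show False
        using ncA[OF fF(1)] by blast
    qed
    then show ?thesis
      using convL' by (auto simp: lattice_free_in_aff_def)
  qed
  moreover have "affine hull F \<inter> int_points \<noteq> {}" if F: "F facet_of L'" for F
  proof -
    obtain c d where cd: "(c, d) \<in> C" "\<And>x. x \<in> F \<Longrightarrow> c \<bullet> x = d"
      using facet_of_cut_out[OF finC] affL' F unfolding L'_def by blast
    have "affine hull F = A \<inter> {x. c \<bullet> x = d}"
      using facet_hyperplane(1)[OF convL' F cd(2)] C[OF cd(1)] affL' by auto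
    then show ?thesis
      using C[OF cd(1)] by auto
  qed
  moreover have "two_hyperplane_property K \<longleftrightarrow> two_hyperplane_property L'"
  proof (rule two_hyperplane_property_cong[OF intL'[symmetric]])
    fix G assume G: "G face_of integer_hull K" "G \<noteq> {}"
    have GK: "G \<subseteq> K"
      using face_of_imp_subset[OF G(1)] integer_hull_subset[OF conv] by blast
    obtain z where z: "z \<in> G" "z \<in> int_points"
      using face_of_integer_hull[OF bnd G(1)] G(2) by (metis IntE convex_hull_empty ex_in_conv)
    show "(\<exists>F. F facet_of K \<and> G \<subseteq> F) \<longleftrightarrow> (\<exists>F. F facet_of L' \<and> G \<subseteq> F)"
    proof
      assume "\<exists>F. F facet_of K \<and> G \<subseteq> F"
      then obtain F where F: "F facet_of K" "G \<subseteq> F"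
        by blast
      then have FF: "F \<in> \<F>"
        using z by (auto simp: \<F>_def)
      \<comment> \<open>The face of \<open>L'\<close> cut out by the kept constraint. It contains
        \<open>F\<close> and is proper, so its dimension is squeezed to that of a facet.\<close>
      define F' where "F' = L' \<inter> {x. fst (f F) \<bullet> x = snd (f F)}"
      have fC: "f F \<in> C"
        using FF by (simp add: C_def)
      have FF': "F \<subseteq> F'"
        using f(3)[OF FF] KL' by (auto simp: F'_def)
      have face: "F' face_of L'"
        unfolding F'_def using convL' L'le[OF fC] by (rule face_of_Int_supporting_hyperplane_le)
      have "F' \<noteq> L'"
      proof
        assume "F' = L'"
        then have "affine hull L' \<subseteq> {x. fst (f F) \<bullet> x = snd (f F)}"
          by (intro hull_minimal affine_hyperplane) (auto simp: F'_def)
        then show False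
          using ncA[OF fC] affL' by simp
      qed
      then have "aff_dim F' < aff_dim L'"
        using face_of_aff_dim_lt[OF convL' face] by blast
      moreover have "aff_dim L' = aff_dim K"
        using affL' K(2) by (metis aff_dim_affine_hull)
      moreover have "aff_dim F = aff_dim K - 1" "F \<noteq> {}"
        using F(1) by (auto simp: facet_of_def)
      moreover have "aff_dim F \<le> aff_dim F'"
        using FF' by (rule aff_dim_subset)
      ultimately have "F' facet_of L'"
        using face FF' unfolding facet_of_def by auto
      then show "\<exists>F. F facet_of L' \<and> G \<subseteq> F"
        using F(2) FF' by blast
    next
      assume "\<exists>F. F facet_of L' \<and> G \<subseteq> F"
      then obtain F' where F': "F' facet_of L'" "G \<subseteq> F'"
        by blast
      obtain c d where cd: "(c, d) \<in> C" "\<And>x. x \<in> F' \<Longrightarrow> c \<bullet> x = d"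
        using facet_of_cut_out[OF finC] affL' F'(1) unfolding L'_def by blast
      \<comment> \<open>A strict cut cannot be tight at the integer point \<open>z\<close> of
        \<open>G\<close>, since \<open>z\<close> is in \<open>K\<close>. So the facet of
        \<open>L'\<close> stems from a kept facet of \<open>K\<close>.\<close>
      have "(c, d) \<notin> J"
      proof
        assume "(c, d) \<in> J"
        then have "c \<bullet> z < d"
          using J(2)[of "(c, d)"] z GK by (auto simp: strict_cut_def)
        then show False
          using cd(2) z F'(2) by fastforce
      qed
      then obtain F where F: "F \<in> \<F>" "(c, d) = f F"
        using cd(1) by (auto simp: C_def)
      then have "F = K \<inter> {x. c \<bullet> x = d}"
        using f(3)[OF F(1)] by (metis fst_conv snd_conv)
      then have "G \<subseteq> F"
        using GK F'(2) cd(2) by auto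
      then show "\<exists>F. F facet_of K \<and> G \<subseteq> F"
        using F(1) by (auto simp: \<F>_def)
    qed
  qed
  ultimately show thesis
    using that ratL' KL' L'A by blast
qed

end

section \<open>Assembling the enlarged polytope\<close>

text \<open>Scaling each difference of a rational generator and \<open>z0\<close> to an integer
  vector leaves the span unchanged.\<close>

lemma lattice_flat_affine_hull:
  assumes "rational_polytope L" "z0 \<in> affine hull L" "z0 \<in> int_points"
  obtains B where "lattice_flat (affine hull L) z0 B"
proof -
  obtain S where S: "finite S" "\<And>x. x \<in> S \<Longrightarrow> rat_vec x" "L = convex hull S"
    using assms(1) by (auto simp: rational_polytope_def)
  have "\<exists>D::nat. D > 0 \<and> real D *\<^sub>R (x - z0) \<in> int_points" if "x \<in> S" for x
    using S(2)[OF that] assms(3) by (metis rat_vec_clear_denominators rat_vec_diff int_points_rat_vec)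
  then obtain D :: "_ \<Rightarrow> nat" where D: "\<And>x. x \<in> S \<Longrightarrow> D x > 0 \<and> real (D x) *\<^sub>R (x - z0) \<in> int_points"
    by metis
  define B where "B = (\<lambda>x. real (D x) *\<^sub>R (x - z0)) ` S"
  have "span B = span ((\<lambda>x. - z0 + x) ` S)"
  proof (rule span_eq[THEN iffD2], intro conjI subsetI)
    fix y assume "y \<in> B"
    then obtain x where "x \<in> S" "y = real (D x) *\<^sub>R (- z0 + x)"
      by (auto simp: B_def)
    then show "y \<in> span ((\<lambda>x. - z0 + x) ` S)"
      by (metis imageI span_base span_scale)
  next
    fix y assume "y \<in> (\<lambda>x. - z0 + x) ` S"
    then obtain x where x: "x \<in> S" "y = x - z0"
      by auto
    then have "y = (1 / real (D x)) *\<^sub>R (real (D x) *\<^sub>R (x - z0))"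
      using D[OF x(1)] by simp
    moreover have "real (D x) *\<^sub>R (x - z0) \<in> span B"
      using x(1) by (auto simp: B_def intro: span_base)
    ultimately show "y \<in> span B"
      by (metis span_scale)
  qed
  then have hull: "affine hull L = (+) z0 ` span B"
    using affine_hull_span_gen[of z0 S] assms(2) S(3) by simp
  have "x \<in> (+) z0 ` span B \<longleftrightarrow> x - z0 \<in> span B" for x
    by (auto intro: image_eqI[of _ _ "x - z0"])
  then have "lattice_flat (affine hull L) z0 B"
    using hull S(1) D assms(3) by unfold_locales (auto simp: B_def)
  then show thesis
    using that by blast
qed

theorem theorem4:
  fixes L :: "(real^'m) set"
  assumes "rational_polytope L"
    and "lattice_free_in_aff L"
    and "aff_dim L \<ge> 1"
    and "affine hull L \<inter> int_points \<noteq> {}"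
  shows "\<exists>L'. rational_polytope L' \<and> L \<subseteq> L' \<and> L' \<subseteq> affine hull L \<and>
           lattice_free_in_aff L' \<and>
           (two_hyperplane_property L \<longleftrightarrow> two_hyperplane_property L') \<and>
           (\<forall>F. F facet_of L' \<longrightarrow>
              affine hull F \<inter> int_points \<noteq> {} \<and>
              (\<exists>H1 H2. facet_split (affine hull L) L' F H1 H2) \<and>
              (\<forall>H1 H2. facet_split (affine hull L) L' F H1 H2 \<longrightarrow>
                  intersecting_split L' H1 H2))"
proof -
  define A where "A = affine hull L"
  obtain z0 where "z0 \<in> A" "z0 \<in> int_points"
    using assms(4) by (auto simp: A_def)
  then obtain B where "lattice_flat A z0 B"
    using lattice_flat_affine_hull[OF assms(1)] unfolding A_def by blast
  then interpret lattice_flat A z0 B .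
  \<comment> \<open>Given (i), condition (ii) follows once \<open>L'\<close> lies in no half-open
    split.\<close>
  have finish: ?thesis if L': "rational_polytope L'" "L \<subseteq> L'" "L' \<subseteq> A" "lattice_free_in_aff L'"
      "two_hyperplane_property L \<longleftrightarrow> two_hyperplane_property L'" "\<not> in_half_open_split L'"
      "\<And>F. F facet_of L' \<Longrightarrow> affine hull F \<inter> int_points \<noteq> {}" for L'
  proof -
    have aff: "affine hull L' = A"
      using hull_mono[OF L'(2), of affine] hull_minimal[OF L'(3), of affine] affine_A by (auto simp: A_def)
    have conv: "convex L'"
      using L'(4) by (simp add: lattice_free_in_aff_def)
    show ?thesis
      unfolding A_def[symmetric]
      using L' facet_split_exists[OF L'(1) aff] facet_split_intersecting[OF conv aff] by blast
  qed
  have "\<exists>b0\<in>B. b0 \<noteq> 0"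
  proof (rule ccontr)
    assume "\<not> ?thesis"
    then have "span B \<subseteq> {0}"
      using span_mono[of B "{0}"] by auto
    then have "A \<subseteq> {z0}"
      by (auto simp: A_eq)
    then have "aff_dim A \<le> 0"
      using aff_dim_subset[of A "{z0}"] by simp
    then show False
      using assms(3) by (simp add: A_def)
  qed
  then obtain b0 where b0: "b0 \<in> B" "b0 \<noteq> 0"
    by blast
  show ?thesis
  proof (cases "\<exists>a b1 b2. split_within_data A a b1 b2 \<and> b1 < b2 \<and> (\<forall>x\<in>L. b1 \<le> a \<bullet> x \<and> a \<bullet> x \<le> b2)")
    case True
    \<comment> \<open>On a line the normal is fixed to be \<open>b0\<close>, so that points of
      \<open>A\<close> are determined by their values.\<close>
    have "\<exists>a b1 b2. split_within_data A a b1 b2 \<and> b1 < b2 \<and> (\<forall>x\<in>L. b1 \<le> a \<bullet> x \<and> a \<bullet> x \<le> b2) \<and>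
        (B \<subseteq> span {b0} \<longrightarrow> a = b0)"
    proof (cases "B \<subseteq> span {b0}")
      case line: True
      obtain b1 b2 where "split_within_data A b0 b1 b2" "b1 < b2" "\<And>x. x \<in> L \<Longrightarrow> b1 \<le> b0 \<bullet> x \<and> b0 \<bullet> x \<le> b2"
        using line_in_strip[OF b0 line assms(2) A_def[symmetric]] by blast
      then show ?thesis
        by blast
    qed (use True in blast)
    then obtain a b1 b2 where sd: "split_within_data A a b1 b2" and less: "b1 < b2"
      and strip: "\<And>x. x \<in> L \<Longrightarrow> b1 \<le> a \<bullet> x \<and> a \<bullet> x \<le> b2" and a: "B \<subseteq> span {b0} \<Longrightarrow> a = b0"
      by blast
    obtain K h1 h2 where K: "rational_polytope K" "L \<subseteq> K" "affine hull K = A"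
      and Kstrip: "\<And>x. x \<in> K \<Longrightarrow> b1 \<le> a \<bullet> x \<and> a \<bullet> x \<le> b2" and nhalf: "\<not> in_half_open_split K"
      and h: "h1 \<in> K" "h1 \<in> int_points" "a \<bullet> h1 = b1" "h2 \<in> K" "h2 \<in> int_points" "a \<bullet> h2 = b2"
      using strip_enlarge[OF sd assms(1) A_def[symmetric] strip less] by blast
    have poly: "polytope K" "polytope L"
      using K(1) assms(1) rational_polytope_imp_polytope by blast+
    have conv: "convex K"
      using poly polytope_imp_convex by blast
    have KA: "K \<subseteq> A"
      using K(3) hull_subset[of K affine] by simp
    \<comment> \<open>Both sides of the required equivalence hold outright, so it does not matter
      that \<open>K\<close> may have more integer points than \<open>L\<close>.\<close>
    have props: "two_hyperplane_property L" "two_hyperplane_property K" "lattice_free_in_aff K"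
      using strip_two_hyperplane[OF sd poly(2) A_def[symmetric] strip]
        strip_two_hyperplane[OF sd poly(1) K(3) Kstrip] strip_lattice_free[OF sd conv K(3) Kstrip] by blast+
    show ?thesis
    proof (cases "B \<subseteq> span {b0}")
      case line: True
      \<comment> \<open>In dimension one \<open>K\<close> is already the segment between two integer
        points, whose facets contain integer points; no relaxation follows.\<close>
      have "x \<in> closed_segment h1 h2" if x: "x \<in> K" for x
      proof -
        have "connected (closed_segment h1 h2)"
          by simp
        then obtain w where w: "w \<in> closed_segment h1 h2" "a \<bullet> w = a \<bullet> x"
          using connected_ivt_hyperplane[of "closed_segment h1 h2" h1 h2 a "a \<bullet> x"] Kstrip[OF x] h by auto
        have "w \<in> A"
          using w(1) h conv KA closed_segment_subset by blast
        then have "w = x"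
          using line_inner_inj[OF line, of w x] w(2) x KA a[OF line] by auto
        then show ?thesis
          using w(1) by simp
      qed
      then have Kseg: "K = convex hull {h1, h2}"
        using closed_segment_subset[OF h(1,4) conv] by (auto simp: segment_convex_hull)
      have "affine hull F \<inter> int_points \<noteq> {}" if F: "F facet_of K" for F
      proof -
        have face: "F face_of convex hull {h1, h2}" and "F \<noteq> {}"
          using F Kseg by (auto simp: facet_of_def)
        obtain T where T: "T \<subseteq> {h1, h2}" "F = convex hull T"
          using face_of_convex_hull_subset[OF _ face] by (metis finite.emptyI finite.insertI finite_imp_compact)
        then obtain t where "t \<in> T"
          using \<open>F \<noteq> {}\<close> by fastforce
        then have "t \<in> affine hull F" "t \<in> int_points"
          using T h by (auto simp: hull_inc)
        then show ?thesis
          by blast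
      qed
      then show ?thesis
        using finish[OF K(1,2) KA props(3) _ nhalf] props by blast
    next
      case False
      obtain L' where L': "rational_polytope L'" "K \<subseteq> L'" "L' \<subseteq> A" "lattice_free_in_aff L'"
        "two_hyperplane_property K \<longleftrightarrow> two_hyperplane_property L'"
        "\<And>F. F facet_of L' \<Longrightarrow> affine hull F \<inter> int_points \<noteq> {}"
        using relax_to_lattice_facets[OF b0 False K(1,3) props(3)] by blast
      have "\<not> in_half_open_split L'"
        using nhalf in_half_open_split_mono[OF L'(2)] by blast
      then show ?thesis
        using finish[of L'] L' K(2) props by blast
    qed
  next
    case nostrip: False
    \<comment> \<open>On a line \<open>L\<close> would lie in a split, so the relaxation for higher
      dimension applies.\<close>
    have noline: "\<not> B \<subseteq> span {b0}"
    proof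
      assume "B \<subseteq> span {b0}"
      then show False
        by (rule line_in_strip[OF b0 _ assms(2) A_def[symmetric]]) (use nostrip in blast)
    qed
    obtain L' where L': "rational_polytope L'" "L \<subseteq> L'" "L' \<subseteq> A" "lattice_free_in_aff L'"
      "two_hyperplane_property L \<longleftrightarrow> two_hyperplane_property L'"
      "\<And>F. F facet_of L' \<Longrightarrow> affine hull F \<inter> int_points \<noteq> {}"
      using relax_to_lattice_facets[OF b0 noline assms(1) A_def[symmetric] assms(2)] by blast
    have "\<not> in_half_open_split L"
    proof
      assume "in_half_open_split L"
      then obtain a b1 b2 where sd: "split_within_data A a b1 b2"
        and half: "\<And>x. x \<in> L \<Longrightarrow> a \<bullet> x = b1 \<or> strictly_between b1 b2 (a \<bullet> x)"
        unfolding in_half_open_split_def by blast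
      \<comment> \<open>A half-open split may have either orientation, whereas the case distinction
        fixes \<open>b1 < b2\<close>.\<close>
      have "b1 < b2 \<or> b2 < b1"
        using sd by (auto simp: split_within_data_def)
      then show False
      proof
        assume "b1 < b2"
        moreover from this have "\<forall>x\<in>L. b1 \<le> a \<bullet> x \<and> a \<bullet> x \<le> b2"
          using half by (fastforce simp: strictly_between_def)
        ultimately show False
          using nostrip sd by blast
      next
        assume "b2 < b1"
        moreover from this have "\<forall>x\<in>L. b2 \<le> a \<bullet> x \<and> a \<bullet> x \<le> b1"
          using half by (fastforce simp: strictly_between_def)
        moreover have "split_within_data A a b2 b1"
          using sd by (simp add: split_within_data_swap)
        ultimately show False
          using nostrip by blast
      qed
    qed
    then have "\<not> in_half_open_split L'"
      using in_half_open_split_mono[OF L'(2)] by blast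
    then show ?thesis
      using finish[of L'] L' by blast
  qed
qed

end
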